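(* For every non-negative integer $j$ there is an integer $r_0$ (depending on $j$) such that for all integers $r \ge r_0$ with $r \equiv 0$ or $1 \pmod{4}$, there exists a pentagonal geometry $\mathrm{PENT}(4,r)$ with precisely $j$ opposite line pairs.
   Context: A partial linear space is a non-empty finite set of points together with a collection of subsets, called lines (or blocks), such that every line contains at least two points and any two distinct points lie together on at most one line. Two distinct points are collinear if some line contains both. For integers $k \ge 2$, $r \ge 1$, a pentagonal geometry $\mathrm{PENT}(k,r)$ is a partial linear space in which every line contains exactly $k$ points, every point lies on exactly $r$ lines, and for each point $x$ there is a line, denoted $x^{\mathrm{opp}}$, consisting of precisely those points $y \ne x$ that are not collinear with $x$. An opposite line pair is an unordered pair of disjoint lines such that for each point $x$ on one of the two lines, $x^{\mathrm{opp}}$ is the other line. *)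

theory Defs
  imports Main
begin

locale partial_linear_space =
  fixes V :: "'a set" and L :: "'a set set"
  assumes points_nonempty: "V \<noteq> {}"
    and points_finite: "finite V"
    and line_subset: "l \<in> L \<Longrightarrow> l \<subseteq> V"
    and line_card: "l \<in> L \<Longrightarrow> 2 \<le> card l"
    and line_unique:
      "\<lbrakk>x \<noteq> y; l \<in> L; m \<in> L; x \<in> l; y \<in> l; x \<in> m; y \<in> m\<rbrakk> \<Longrightarrow> l = m"

definition collinear :: "'a set set \<Rightarrow> 'a \<Rightarrow> 'a \<Rightarrow> bool" where
  "collinear L x y \<longleftrightarrow> x \<noteq> y \<and> (\<exists>l\<in>L. x \<in> l \<and> y \<in> l)"

definition opp :: "'a set \<Rightarrow> 'a set set \<Rightarrow> 'a \<Rightarrow> 'a set" where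
  "opp V L x = {y \<in> V. y \<noteq> x \<and> \<not> collinear L x y}"

locale PENT = partial_linear_space V L
  for k r :: nat and V :: "'a set" and L :: "'a set set" +
  assumes k_ge_2: "2 \<le> k"
    and r_ge_1: "1 \<le> r"
    and line_size: "l \<in> L \<Longrightarrow> card l = k"
    and point_degree: "x \<in> V \<Longrightarrow> card {l \<in> L. x \<in> l} = r"
    and opp_line: "x \<in> V \<Longrightarrow> opp V L x \<in> L"

text \<open>Each unordered pair of lines is encoded as the two-element set \<open>{l, m}\<close>; \<open>l\<close> and \<open>m\<close> differ
  because they are disjoint and lines are non-empty.\<close>

definition opposite_line_pairs :: "'a set \<Rightarrow> 'a set set \<Rightarrow> 'a set set set" where
  "opposite_line_pairs V L =
    {{l, m} | l m. l \<in> L \<and> m \<in> L \<and> disjnt l m \<and>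
      (\<forall>x\<in>l. opp V L x = m) \<and> (\<forall>x\<in>m. opp V L x = l)}"

end

theory Submission
  imports Defs "HOL-Number_Theory.Cong"
begin

text \<open>
  For a pentagonal geometry, call two points adjacent if they are not collinear; this deficiency
  graph is 4-regular, and a \<open>PENT(4, r)\<close> is a decomposition into copies of \<open>K\<^sub>4\<close> of the complement
  of a graph \<open>D\<close> in which every neighbourhood of \<open>D\<close> is one of the blocks. It has \<open>3 r + 5\<close> points, so
  \<open>12 x + 5\<close> or \<open>12 x + 8\<close>, and its opposite line pairs are the components of \<open>D\<close> that are
  complete bipartite.

  Fix a hole size \<open>w\<close> in \<open>{5, 8}\<close> and let \<open>X\<close> be the set of all \<open>x\<close> for which there is such a structure on
  \<open>12 x\<close> points plus a hole of \<open>w\<close> points, without opposite pairs. Truncating a transversal design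
  \<open>TD(8, n)\<close>, giving weight 12 to its points (4-GDDs of type \<open>12\<^sup>s\<close> exist for \<open>4 \<le> s \<le> 8\<close>) and filling
  the groups shows that \<open>X\<close> contains \<open>4 n + a + b + c + d\<close> whenever \<open>n, a, b, c, d\<close> are in \<open>X\<close>,
  \<open>a, b, c, d \<le> n\<close> and \<open>n\<close> is coprime to 30. Starting from two explicit structures, \<open>5\<close> and \<open>7\<close>, this
  already yields all \<open>x \<ge> 768\<close>. Filling one further group of arbitrary size with a given pentagonal
  geometry, a single geometry with \<open>j\<close> opposite pairs produces geometries with \<open>j\<close> opposite pairs for
  all large orders in its class modulo 12. For the orders \<open>12 x + 5\<close>, explicit geometries on 65 points
  treat \<open>j = 0\<close> and \<open>j = 1\<close>; the general \<open>j\<close> follows by induction, filling the groups of a 4-GDD of type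
  \<open>v\<^sup>1\<^sup>3\<close> with geometries of the same order whose numbers of pairs add up. A 4-GDD of type \<open>v\<^sup>4\<close> passes from
  the orders \<open>12 x + 5\<close> to \<open>12 x + 8\<close>.
\<close>

section \<open>Graph decompositions and group divisible designs\<close>

text \<open>Graphs are relations containing each edge in both orientations, so that edge-disjoint
  unions and differences of graphs are plain set operations.\<close>

definition complete :: "'a set \<Rightarrow> ('a \<times> 'a) set" where
  "complete S = {(x, y). x \<in> S \<and> y \<in> S \<and> x \<noteq> y}"

text \<open>A partition of the edges of \<open>E\<close> into cliques; group divisible designs and
  designs with a hole differ only in \<open>E\<close>. The bound \<open>2 \<le> card B\<close>
  excludes trivial blocks and makes every block finite.\<close>

definition decomp :: "nat set \<Rightarrow> ('a \<times> 'a) set \<Rightarrow> 'a set set \<Rightarrow> bool" where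
  "decomp K E L \<longleftrightarrow>
    (\<forall>B\<in>L. card B \<in> K \<and> 2 \<le> card B \<and> complete B \<subseteq> E) \<and>
    (\<forall>(x, y)\<in>E. x \<noteq> y \<and> (\<exists>!B. B \<in> L \<and> x \<in> B \<and> y \<in> B))"

text \<open>The lexicographic product with an edgeless graph: every vertex receives weight
  \<open>card U\<close>.\<close>

definition blow :: "('a \<times> 'a) set \<Rightarrow> 'b set \<Rightarrow> (('a \<times> 'b) \<times> ('a \<times> 'b)) set" where
  "blow E U = {((i, u), (j, v)). (i, j) \<in> E \<and> u \<in> U \<and> v \<in> U}"

text \<open>Group divisible designs with \<open>s\<close> groups of size \<open>g\<close>. The
  groups are the fibres of the first coordinate, that is, the parts of a complete multipartite
  graph.\<close>

definition gdd :: "nat set \<Rightarrow> nat \<Rightarrow> nat \<Rightarrow> bool" where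
  "gdd K g s \<longleftrightarrow> (\<exists>L. decomp K (blow (complete {..<s}) {..<g}) L)"

lemma completeI [intro]: "x \<in> S \<Longrightarrow> y \<in> S \<Longrightarrow> x \<noteq> y \<Longrightarrow> (x, y) \<in> complete S"
  by (simp add: complete_def)

lemma completeE [elim]: "(x, y) \<in> complete S \<Longrightarrow> (x \<in> S \<Longrightarrow> y \<in> S \<Longrightarrow> x \<noteq> y \<Longrightarrow> P) \<Longrightarrow> P"
  by (simp add: complete_def)

lemma decompI:
  assumes "\<And>B. B \<in> L \<Longrightarrow> card B \<in> K" and "\<And>B. B \<in> L \<Longrightarrow> 2 \<le> card B"
    and "\<And>B x y. B \<in> L \<Longrightarrow> x \<in> B \<Longrightarrow> y \<in> B \<Longrightarrow> x \<noteq> y \<Longrightarrow> (x, y) \<in> E"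
    and "\<And>x y. (x, y) \<in> E \<Longrightarrow> x \<noteq> y"
    and "\<And>x y. (x, y) \<in> E \<Longrightarrow> \<exists>B\<in>L. x \<in> B \<and> y \<in> B"
    and "\<And>x y B C. (x, y) \<in> E \<Longrightarrow> B \<in> L \<Longrightarrow> C \<in> L \<Longrightarrow> x \<in> B \<Longrightarrow> y \<in> B \<Longrightarrow> x \<in> C \<Longrightarrow> y \<in> C \<Longrightarrow> B = C"
  shows "decomp K E L"
  unfolding decomp_def complete_def
proof (intro conjI ballI)
  fix e assume e: "e \<in> E"
  obtain x y where xy: "e = (x, y)" by (cases e)
  from assms(4-6) e show "case e of (x, y) \<Rightarrow> x \<noteq> y \<and> (\<exists>!B. B \<in> L \<and> x \<in> B \<and> y \<in> B)"
    unfolding xy by simp metis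
qed (use assms(1-3) in auto)

lemma decompD:
  assumes "decomp K E L"
  shows "B \<in> L \<Longrightarrow> card B \<in> K" "B \<in> L \<Longrightarrow> 2 \<le> card B" "B \<in> L \<Longrightarrow> finite B"
    and "B \<in> L \<Longrightarrow> x \<in> B \<Longrightarrow> y \<in> B \<Longrightarrow> x \<noteq> y \<Longrightarrow> (x, y) \<in> E"
    and "(x, y) \<in> E \<Longrightarrow> x \<noteq> y"
    and "(x, y) \<in> E \<Longrightarrow> \<exists>B\<in>L. x \<in> B \<and> y \<in> B"
    and "(x, y) \<in> E \<Longrightarrow> B \<in> L \<Longrightarrow> C \<in> L \<Longrightarrow> x \<in> B \<Longrightarrow> y \<in> B \<Longrightarrow> x \<in> C \<Longrightarrow> y \<in> C \<Longrightarrow> B = C"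
proof -
  show *: "B \<in> L \<Longrightarrow> card B \<in> K" "B \<in> L \<Longrightarrow> 2 \<le> card B"
    and "B \<in> L \<Longrightarrow> x \<in> B \<Longrightarrow> y \<in> B \<Longrightarrow> x \<noteq> y \<Longrightarrow> (x, y) \<in> E"
    and "(x, y) \<in> E \<Longrightarrow> x \<noteq> y"
    and "(x, y) \<in> E \<Longrightarrow> \<exists>B\<in>L. x \<in> B \<and> y \<in> B"
    using assms unfolding decomp_def complete_def by auto
  show "B \<in> L \<Longrightarrow> finite B"
    using *(2) card.infinite by fastforce
  show "B = C" if "(x, y) \<in> E" "B \<in> L" "C \<in> L" "x \<in> B" "y \<in> B" "x \<in> C" "y \<in> C"
  proof -
    have "\<exists>!B. B \<in> L \<and> x \<in> B \<and> y \<in> B"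
      using bspec[OF conjunct2[OF assms[unfolded decomp_def]] that(1)] by simp
    then show ?thesis using that(2-) by (elim ex1E) metis
  qed
qed

lemma decomp_block_subset:
  assumes "decomp K E L" "E \<subseteq> S \<times> S" "B \<in> L"
  shows "B \<subseteq> S"
proof
  fix x assume x: "x \<in> B"
  have "\<not> B \<subseteq> {x}"
    using decompD(2)[OF assms(1,3)] card_mono[of "{x}" B] by auto
  then obtain y where "y \<in> B" "y \<noteq> x" by blast
  with decompD(4)[OF assms(1,3) x] assms(2) show "x \<in> S" by blast
qed

text \<open>Any two points of a block form an edge, and an edge belongs to one graph only; hence two
  blocks sharing an edge come from the same index.\<close>

lemma decomp_UN:
  assumes d: "\<And>i. i \<in> I \<Longrightarrow> decomp K (E i) (L i)"
    and disj: "\<And>i j. i \<in> I \<Longrightarrow> j \<in> I \<Longrightarrow> i \<noteq> j \<Longrightarrow> E i \<inter> E j = {}"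
  shows "decomp K (\<Union>i\<in>I. E i) (\<Union>i\<in>I. L i)"
proof (rule decompI)
  fix x y B C assume xy: "(x, y) \<in> (\<Union>i\<in>I. E i)" and B: "B \<in> (\<Union>i\<in>I. L i)" and C: "C \<in> (\<Union>i\<in>I. L i)"
    and m: "x \<in> B" "y \<in> B" "x \<in> C" "y \<in> C"
  obtain i where i: "i \<in> I" "(x, y) \<in> E i" using xy by blast
  have ne: "x \<noteq> y" using decompD(5)[OF d[OF i(1)]] i(2) by simp
  obtain j where j: "j \<in> I" "B \<in> L j" using B by blast
  obtain k where k: "k \<in> I" "C \<in> L k" using C by blast
  have "(x, y) \<in> E j" using decompD(4)[OF d[OF j(1)] j(2) m(1,2) ne] .
  then have ji: "j = i" using disj[OF j(1) i(1)] i(2) by blast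
  have "(x, y) \<in> E k" using decompD(4)[OF d[OF k(1)] k(2) m(3,4) ne] .
  then have ki: "k = i" using disj[OF k(1) i(1)] i(2) by blast
  show "B = C"
    using decompD(7)[OF d[OF i(1)] i(2) _ _ m] j(2) k(2) ji ki by simp
next
  fix x y assume "(x, y) \<in> (\<Union>i\<in>I. E i)"
  then obtain i where i: "i \<in> I" "(x, y) \<in> E i" by blast
  show "x \<noteq> y" by (rule decompD(5)[OF d[OF i(1)] i(2)])
  show "\<exists>B\<in>\<Union>i\<in>I. L i. x \<in> B \<and> y \<in> B"
    using decompD(6)[OF d[OF i(1)] i(2)] i(1) by blast
next
  fix B assume "B \<in> (\<Union>i\<in>I. L i)"
  then obtain i where i: "i \<in> I" "B \<in> L i" by blast
  show "card B \<in> K" "2 \<le> card B" using decompD(1,2)[OF d[OF i(1)] i(2)] .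
  show "(x, y) \<in> (\<Union>i\<in>I. E i)" if "x \<in> B" "y \<in> B" "x \<noteq> y" for x y
    using decompD(4)[OF d[OF i(1)] i(2) that] i(1) by blast
qed

lemma decomp_Un:
  assumes "decomp K E L" "decomp K E' L'" "E \<inter> E' = {}"
  shows "decomp K (E \<union> E') (L \<union> L')"
proof -
  have "decomp K (\<Union>b\<in>UNIV. if b then E else E') (\<Union>b\<in>UNIV. if b then L else L')"
  proof (rule decomp_UN)
    show "decomp K (if b then E else E') (if b then L else L')" for b
      using assms by (cases b) simp_all
    show "(if b then E else E') \<inter> (if c then E else E') = {}" if "b \<noteq> c" for b c
      using assms that by (cases b; cases c) auto
  qed
  then show ?thesis by (simp add: UNIV_bool Un_commute)
qed

lemma decomp_empty [simp]: "decomp K {} {}"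
  by (simp add: decomp_def)

lemma decomp_image:
  assumes d: "decomp K E L" and E: "E \<subseteq> S \<times> S" and f: "inj_on f S"
  shows "decomp K (map_prod f f ` E) ((`) f ` L)"
proof (rule decompI)
  have sub: "B \<subseteq> S" if "B \<in> L" for B using decomp_block_subset[OF d E that] .
  have c: "card (f ` B) = card B" if "B \<in> L" for B
    using card_image[OF inj_on_subset[OF f sub[OF that]]] .
  show "card B \<in> K" "2 \<le> card B" if "B \<in> (`) f ` L" for B
    using that c decompD(1,2)[OF d] by auto
  show "(x, y) \<in> map_prod f f ` E" if B: "B \<in> (`) f ` L" "x \<in> B" "y \<in> B" and ne: "x \<noteq> y" for x y B
  proof -
    obtain B' a b where B': "B' \<in> L" "a \<in> B'" "b \<in> B'" "x = f a" "y = f b" using B by auto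
    then have "(a, b) \<in> E" using decompD(4)[OF d B'(1-3)] ne by blast
    then show ?thesis using B' by (auto intro: rev_image_eqI[of "(a, b)"])
  qed
  fix x y assume xy: "(x, y) \<in> map_prod f f ` E"
  then obtain a b where ab: "(a, b) \<in> E" "x = f a" "y = f b" by auto
  have ab': "a \<in> S" "b \<in> S" using ab(1) E by auto
  show "x \<noteq> y" using decompD(5)[OF d ab(1)] ab ab' inj_onD[OF f, of a b] by auto
  show "\<exists>B\<in>(`) f ` L. x \<in> B \<and> y \<in> B" using decompD(6)[OF d ab(1)] ab by auto
  fix B C assume B: "B \<in> (`) f ` L" and C: "C \<in> (`) f ` L"
    and m: "x \<in> B" "y \<in> B" "x \<in> C" "y \<in> C"
  obtain B' C' where BC: "B' \<in> L" "B = f ` B'" "C' \<in> L" "C = f ` C'" using B C by auto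
  have "a \<in> B'" "b \<in> B'" "a \<in> C'" "b \<in> C'"
    using m inj_on_image_mem_iff[OF f ab'(1) sub] inj_on_image_mem_iff[OF f ab'(2) sub] BC ab by auto
  then show "B = C" using decompD(7)[OF d ab(1) BC(1,3)] BC by simp
qed

text \<open>Truncation of a design: blocks are cut down to \<open>S\<close>, and traces with fewer
  than two points, which carry no edge, are discarded.\<close>

lemma decomp_restrict:
  assumes d: "decomp K E L" and K: "\<And>B. B \<in> L \<Longrightarrow> 2 \<le> card (B \<inter> S) \<Longrightarrow> card (B \<inter> S) \<in> K'"
  shows "\<exists>L'. decomp K' (E \<inter> S \<times> S) L'"
proof
  let ?L = "(\<lambda>B. B \<inter> S) ` {B \<in> L. 2 \<le> card (B \<inter> S)}"
  show "decomp K' (E \<inter> S \<times> S) ?L"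
  proof (rule decompI)
    fix x y assume xy: "(x, y) \<in> E \<inter> S \<times> S"
    show ne: "x \<noteq> y" using xy decompD(5)[OF d, of x y] by simp
    obtain B where B: "B \<in> L" "x \<in> B" "y \<in> B" using decompD(6)[OF d, of x y] xy by auto
    have "card {x, y} \<le> card (B \<inter> S)"
      by (rule card_mono) (use decompD(3)[OF d B(1)] B xy in auto)
    then have "2 \<le> card (B \<inter> S)" using ne by simp
    then show "\<exists>B\<in>?L. x \<in> B \<and> y \<in> B"
      using B xy by auto
  next
    fix x y B C assume *: "(x, y) \<in> E \<inter> S \<times> S" "B \<in> ?L" "C \<in> ?L" "x \<in> B" "y \<in> B" "x \<in> C" "y \<in> C"
    obtain B' C' where "B' \<in> L" "C' \<in> L" "B = B' \<inter> S" "C = C' \<inter> S" using * by auto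
    then show "B = C" using decompD(7)[OF d, of x y B' C'] * by auto
  next
    fix B assume "B \<in> ?L"
    then obtain B' where B: "B' \<in> L" "B = B' \<inter> S" "2 \<le> card (B' \<inter> S)" by auto
    show "card B \<in> K'" "2 \<le> card B" using B K by auto
    show "(x, y) \<in> E \<inter> S \<times> S" if "x \<in> B" "y \<in> B" "x \<noteq> y" for x y
      using that B decompD(4)[OF d B(1), of x y] by auto
  qed
qed

section \<open>Weighting of points and transversal designs\<close>

lemma gdd_transfer:
  assumes g: "gdd K (card U) (card I)" and fin: "finite I" "finite U"
  shows "\<exists>L. decomp K (blow (complete I) U) L"
proof -
  obtain L where L: "decomp K (blow (complete {..<card I}) {..<card U}) L"
    using g by (auto simp: gdd_def)
  obtain f where f: "bij_betw f {..<card I} I"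
    using ex_bij_betw_nat_finite[OF fin(1)] atLeast0LessThan by metis
  obtain h where h: "bij_betw h {..<card U} U"
    using ex_bij_betw_nat_finite[OF fin(2)] atLeast0LessThan by metis
  have inj: "inj_on (map_prod f h) ({..<card I} \<times> {..<card U})"
    using f h by (auto simp: bij_betw_def inj_on_def)
  have sub: "blow (complete {..<card I}) {..<card U} \<subseteq> ({..<card I} \<times> {..<card U}) \<times> ({..<card I} \<times> {..<card U})"
    by (auto simp: blow_def complete_def)
  have "map_prod (map_prod f h) (map_prod f h) ` blow (complete {..<card I}) {..<card U} = blow (complete I) U" (is "?l = ?r")
  proof
    show "?l \<subseteq> ?r"
      using f h by (auto simp: blow_def complete_def bij_betw_def inj_on_def)
    show "?r \<subseteq> ?l"
    proof
      fix e assume "e \<in> ?r"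
      then obtain i u j v where e: "e = ((i, u), (j, v))" "i \<in> I" "j \<in> I" "i \<noteq> j" "u \<in> U" "v \<in> U"
        by (auto simp: blow_def complete_def)
      obtain i' j' where ij: "i = f i'" "j = f j'" "i' < card I" "j' < card I"
        using e f unfolding bij_betw_def by (metis imageE lessThan_iff)
      obtain u' v' where uv: "u = h u'" "v = h v'" "u' < card U" "v' < card U"
        using e h unfolding bij_betw_def by (metis imageE lessThan_iff)
      show "e \<in> ?l"
        by (rule rev_image_eqI[of "((i', u'), (j', v'))"])
          (use e ij uv in \<open>auto simp: blow_def complete_def\<close>)
    qed
  qed
  then show ?thesis using decomp_image[OF L sub inj] by metis
qed

text \<open>Wilson's fundamental construction: each point gets weight \<open>card U\<close>, and
  each block of size \<open>k\<close> is replaced by a group divisible design on its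
  \<open>k\<close> new groups.\<close>

lemma decomp_blow:
  assumes d: "decomp K E L" and U: "finite U" and g: "\<And>k. k \<in> K \<Longrightarrow> gdd K' (card U) k"
  shows "\<exists>L'. decomp K' (blow E U) L'"
proof -
  have "\<forall>B\<in>L. \<exists>L'. decomp K' (blow (complete B) U) L'"
    using gdd_transfer[OF g[OF decompD(1)[OF d]] decompD(3)[OF d] U] by blast
  then obtain F where F: "\<And>B. B \<in> L \<Longrightarrow> decomp K' (blow (complete B) U) (F B)" by metis
  have "E = (\<Union>B\<in>L. complete B)"
  proof (intro set_eqI iffI)
    fix e assume e: "e \<in> E"
    obtain x y where xy: "e = (x, y)" by (cases e)
    show "e \<in> (\<Union>B\<in>L. complete B)"
      using decompD(5,6)[OF d e[unfolded xy]] xy by blast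
  next
    fix e assume "e \<in> (\<Union>B\<in>L. complete B)"
    then obtain B x y where "B \<in> L" "x \<in> B" "y \<in> B" "x \<noteq> y" "e = (x, y)"
      by (auto simp: complete_def)
    then show "e \<in> E" using decompD(4)[OF d] by blast
  qed
  then have eq: "(\<Union>B\<in>L. blow (complete B) U) = blow E U"
    by (auto simp: blow_def)
  have "decomp K' (\<Union>B\<in>L. blow (complete B) U) (\<Union>B\<in>L. F B)"
  proof (rule decomp_UN[OF F])
    fix B C assume BC: "B \<in> L" "C \<in> L" "B \<noteq> C"
    show "blow (complete B) U \<inter> blow (complete C) U = {}"
    proof (rule ccontr)
      assume "\<not> ?thesis"
      then obtain i j where "i \<in> B" "j \<in> B" "i \<noteq> j" "i \<in> C" "j \<in> C"
        by (auto simp: blow_def complete_def)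
      with decompD(7)[OF d decompD(4)[OF d BC(1)] BC(1,2), of i j] BC(3) show False by blast
    qed
  qed
  then show ?thesis unfolding eq by blast
qed

text \<open>The weighted copies of a point stay in its group, so groups grow from \<open>g\<close>
  to \<open>g * h\<close> points; copy \<open>v\<close> of point \<open>u\<close> is numbered
  \<open>u * h + v\<close>.\<close>

lemma gdd_mult:
  assumes a: "gdd K g s" and b: "\<And>k. k \<in> K \<Longrightarrow> gdd K' h k"
  shows "gdd K' (g * h) s"
proof -
  obtain L where L: "decomp K (blow (complete {..<s}) {..<g}) L"
    using a by (auto simp: gdd_def)
  obtain L' where L': "decomp K' (blow (blow (complete {..<s}) {..<g}) {..<h}) L'"
    using decomp_blow[OF L, of "{..<h}" K'] b by auto
  define f :: "(nat \<times> nat) \<times> nat \<Rightarrow> nat \<times> nat" where "f = (\<lambda>((i, u), v). (i, u * h + v))"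
  let ?S = "({..<s} \<times> {..<g}) \<times> {..<h}"
  have inj: "inj_on f ?S"
  proof (rule inj_onI)
    fix p q assume pq: "p \<in> ?S" "q \<in> ?S" "f p = f q"
    obtain i u v where p: "p = ((i, u), v)" by (metis surj_pair)
    obtain i' u' v' where q: "q = ((i', u'), v')" by (metis surj_pair)
    have e: "i = i'" "u * h + v = u' * h + v'" "v < h" "v' < h" using pq p q by (auto simp: f_def)
    have "u = (u * h + v) div h" "u' = (u' * h + v') div h" using e(3,4) by (auto simp: div_mult_self3)
    then have "u = u'" using e(2) by metis
    then show "p = q" using p q e by simp
  qed
  have lt: "u * h + v < g * h" if "u < g" "v < h" for u v
  proof -
    have "u * h + v < Suc u * h" using that by simp
    also have "\<dots> \<le> g * h" using that by (intro mult_right_mono) auto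
    finally show ?thesis .
  qed
  have "map_prod f f ` blow (blow (complete {..<s}) {..<g}) {..<h} = blow (complete {..<s}) {..<g * h}" (is "?l = ?r")
  proof
    show "?l \<subseteq> ?r" using lt by (auto simp: blow_def f_def)
    show "?r \<subseteq> ?l"
    proof
      fix e assume "e \<in> ?r"
      then obtain i u j v where e: "e = ((i, u), (j, v))" "(i, j) \<in> complete {..<s}" "u < g * h" "v < g * h"
        by (auto simp: blow_def)
      have h: "h > 0" using e(3) by (cases h) auto
      show "e \<in> ?l"
        by (rule rev_image_eqI[of "(((i, u div h), u mod h), ((j, v div h), v mod h))"])
          (use e h in \<open>auto simp: blow_def f_def less_mult_imp_div_less\<close>)
    qed
  qed
  moreover have "blow (blow (complete {..<s}) {..<g}) {..<h} \<subseteq> ?S \<times> ?S"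
    by (auto simp: blow_def complete_def)
  ultimately show ?thesis
    using decomp_image[OF L' _ inj] unfolding gdd_def by metis
qed

text \<open>A transversal design \<open>TD(k, n)\<close>: the blocks are the graphs of the functions
  \<open>a * i + b\<close> modulo \<open>n\<close> on the first \<open>k - 1\<close> groups,
  extended by the slope \<open>a\<close> in the last group. Two values at places that differ by
  \<open>d\<close> determine the slope because \<open>d\<close> is invertible modulo
  \<open>n\<close>.\<close>

lemma gdd_transversal:
  assumes cop: "\<And>d. 0 < d \<Longrightarrow> d < k - 1 \<Longrightarrow> coprime d n" and k: "2 \<le> k"
  shows "gdd {k} n k"
proof -
  define f where "f a b i = (if i < k - 1 then (a * i + b) mod n else a)" for a b i :: nat
  define bl where "bl a b = (\<lambda>i. (i, f a b i)) ` {..<k}" for a b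
  have card_bl: "card (bl a b) = k" for a b
    unfolding bl_def by (subst card_image) (auto simp: inj_on_def)
  have inj: "a = a' \<and> b = b'"
    if "i < j" "j < k" and lt: "a < n" "b < n" "a' < n" "b' < n"
      and e: "f a b i = f a' b' i" "f a b j = f a' b' j" for a b a' b' i j
  proof -
    have "i < k - 1" using \<open>i < j\<close> \<open>j < k\<close> by linarith
    then have i: "[a * i + b = a' * i + b'] (mod n)"
      using e(1) by (simp add: f_def cong_def)
    have a: "a = a'"
    proof (cases "j < k - 1")
      case True
      have "a * j = a * i + a * (j - i)" "a' * j = a' * i + a' * (j - i)"
        using \<open>i < j\<close> by (simp_all add: add_mult_distrib2[symmetric])
      then have "[a * (j - i) + (a * i + b) = a' * (j - i) + (a' * i + b')] (mod n)"
        using e True by (simp add: f_def cong_def ac_simps)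
      then have "[a * (j - i) + (a * i + b) = a' * (j - i) + (a * i + b)] (mod n)"
        using i by (meson cong_add cong_refl cong_sym cong_trans)
      then have "[a * (j - i) = a' * (j - i)] (mod n)"
        by (simp only: cong_add_rcancel_nat)
      then have "[a = a'] (mod n)"
        using cong_mult_rcancel_nat[OF cop[of "j - i"]] True \<open>i < j\<close> by simp
      then show ?thesis using lt cong_less_modulus_unique_nat by blast
    next
      case False
      then show ?thesis using e by (simp add: f_def)
    qed
    have "[b = b'] (mod n)" using i a by (simp add: cong_add_lcancel_nat)
    then have "b = b'" using lt cong_less_modulus_unique_nat by blast
    with a show ?thesis by simp
  qed
  have inj': "a = a' \<and> b = b'"
    if "i \<noteq> j" "i < k" "j < k" "a < n" "b < n" "a' < n" "b' < n"
      "f a b i = f a' b' i" "f a b j = f a' b' j" for a b a' b' i j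
    using that inj[of i j a b a' b'] inj[of j i a b a' b'] by (cases "i < j") auto
  have flt: "f a b i < n" if "a < n" "b < n" for a b i
    using that by (auto simp: f_def)
  \<comment> \<open>Distinct \<open>(a, b)\<close> give distinct pairs of values at \<open>i\<close>
    and \<open>j\<close>, so by finiteness every pair of values is attained.\<close>
  have surj: "\<exists>a b. a < n \<and> b < n \<and> f a b i = u \<and> f a b j = v"
    if ij: "i \<noteq> j" "i < k" "j < k" and uv: "u < n" "v < n" for i j u v
  proof -
    let ?g = "\<lambda>(a, b). (f a b i, f a b j)"
    have "?g ` ({..<n} \<times> {..<n}) = {..<n} \<times> {..<n}"
    proof (rule endo_inj_surj)
      show "inj_on ?g ({..<n} \<times> {..<n})"
        by (rule inj_onI) (use inj'[OF ij] in \<open>auto simp: split_def\<close>)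
    qed (use flt in auto)
    then have "(u, v) \<in> ?g ` ({..<n} \<times> {..<n})" using uv by simp
    then show ?thesis by auto
  qed
  have mem: "(i, u) \<in> bl a b \<longleftrightarrow> i < k \<and> u = f a b i" for i u a b
    by (auto simp: bl_def)
  let ?L = "{bl a b | a b. a < n \<and> b < n}"
  have "decomp {k} (blow (complete {..<k}) {..<n}) ?L"
  proof (rule decompI)
    show "card B \<in> {k}" "2 \<le> card B" if "B \<in> ?L" for B
      using that card_bl k by auto
    show "(x, y) \<in> blow (complete {..<k}) {..<n}" if B: "B \<in> ?L" and xy: "x \<in> B" "y \<in> B" "x \<noteq> y" for B x y
      using B xy flt by (auto simp: blow_def complete_def bl_def)
    fix x y assume "(x, y) \<in> blow (complete {..<k}) {..<n}"
    then obtain i u j v where xy: "x = (i, u)" "y = (j, v)" and ij: "i \<noteq> j" "i < k" "j < k" "u < n" "v < n"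
      by (auto simp: blow_def complete_def)
    show "x \<noteq> y" using xy ij by simp
    obtain a b where "a < n" "b < n" "f a b i = u" "f a b j = v" using surj[OF ij] by blast
    then have "bl a b \<in> ?L" "x \<in> bl a b" "y \<in> bl a b" using xy ij mem by auto
    then show "\<exists>B\<in>?L. x \<in> B \<and> y \<in> B" by blast
    fix B C assume BC: "B \<in> ?L" "C \<in> ?L" "x \<in> B" "y \<in> B" "x \<in> C" "y \<in> C"
    then obtain a b a' b' where ab: "B = bl a b" "C = bl a' b'" "a < n" "b < n" "a' < n" "b' < n" by blast
    have "a = a' \<and> b = b'"
      by (rule inj'[OF ij(1-3) ab(3-6)]) (use BC ab(1,2) xy mem in auto)
    then show "B = C" using ab by simp
  qed
  then show ?thesis unfolding gdd_def by blast
qed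

section \<open>Deficiency graphs with holes\<close>

text \<open>A pentagonal geometry with hole \<open>W\<close>: the deficiency graph lives on
  \<open>A\<close> alone, and pairs inside the hole are not covered. For empty \<open>W\<close> it
  describes a pentagonal geometry by its deficiency graph.\<close>

definition fill :: "'a set \<Rightarrow> 'a set \<Rightarrow> ('a \<times> 'a) set \<Rightarrow> 'a set set \<Rightarrow> bool" where
  "fill A W D L \<longleftrightarrow> A \<inter> W = {} \<and> D \<subseteq> complete A \<and> sym D \<and>
    decomp {4} (complete (A \<union> W) - complete W - D) L \<and> (\<forall>x\<in>A. D `` {x} \<in> L)"

text \<open>The complete bipartite components of the deficiency graph, each given by its two sides.
  Non-emptiness keeps out the pair of two empty sets, for which the other conditions hold
  vacuously.\<close>

definition opps :: "('a \<times> 'a) set \<Rightarrow> 'a set set set" where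
  "opps D = {{l, m} | l m. l \<noteq> {} \<and> m \<noteq> {} \<and> (\<forall>x\<in>l. D `` {x} = m) \<and> (\<forall>x\<in>m. D `` {x} = l)}"

lemma oppsI:
  assumes "l \<noteq> {}" "m \<noteq> {}" "\<And>x. x \<in> l \<Longrightarrow> D `` {x} = m" "\<And>x. x \<in> m \<Longrightarrow> D `` {x} = l"
  shows "{l, m} \<in> opps D"
  unfolding opps_def using assms by (intro CollectI exI[of _ l] exI[of _ m]) simp

text \<open>Both sides lie in the vertex set because their points have non-empty neighbourhoods;
  they are disjoint because \<open>D\<close> is irreflexive.\<close>

lemma oppsE:
  assumes "p \<in> opps D" "D \<subseteq> complete A"
  obtains l m where "p = {l, m}" "l \<noteq> {}" "m \<noteq> {}" "\<forall>x\<in>l. D `` {x} = m" "\<forall>x\<in>m. D `` {x} = l"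
    "l \<subseteq> A" "m \<subseteq> A" "l \<inter> m = {}"
proof -
  obtain l m where lm: "p = {l, m}" "l \<noteq> {}" "m \<noteq> {}" "\<forall>x\<in>l. D `` {x} = m" "\<forall>x\<in>m. D `` {x} = l"
    using assms(1) unfolding opps_def by blast
  have "l \<subseteq> A"
  proof
    fix x assume "x \<in> l"
    then have "D `` {x} \<noteq> {}" using lm by simp
    then show "x \<in> A" using assms(2) by (auto simp: complete_def)
  qed
  moreover have "m \<subseteq> A"
  proof
    fix x assume "x \<in> m"
    then have "D `` {x} \<noteq> {}" using lm by simp
    then show "x \<in> A" using assms(2) by (auto simp: complete_def)
  qed
  moreover have "l \<inter> m = {}"
  proof (rule ccontr)
    assume "l \<inter> m \<noteq> {}"
    then obtain x where "x \<in> l" "x \<in> m" by blast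
    then have "x \<in> D `` {x}" using lm(4) by auto
    then show False using assms(2) by (auto simp: complete_def)
  qed
  ultimately show thesis using that[OF lm] by simp
qed

lemma opps_Union:
  assumes "p \<in> opps D" "D \<subseteq> complete A"
  shows "\<Union>p \<subseteq> A" "\<Union>p \<noteq> {}"
proof -
  obtain l m where "p = {l, m}" "l \<noteq> {}" "l \<subseteq> A" "m \<subseteq> A"
    by (rule oppsE[OF assms], rule that)
  then show "\<Union>p \<subseteq> A" "\<Union>p \<noteq> {}" by auto
qed

lemma opps_finite:
  assumes "D \<subseteq> complete A" "finite A"
  shows "finite (opps D)"
proof (rule finite_subset)
  show "opps D \<subseteq> Pow (Pow A)" using opps_Union(1)[OF _ assms(1)] by blast
qed (use assms(2) in simp)

text \<open>Neighbourhoods in the union stay inside one \<open>A i\<close>. One point of a pair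
  therefore fixes the index, and both sides lie in the same part.\<close>

lemma opps_UN:
  assumes D: "\<And>i. i \<in> I \<Longrightarrow> D i \<subseteq> complete (A i)"
    and disj: "\<And>i j. i \<in> I \<Longrightarrow> j \<in> I \<Longrightarrow> i \<noteq> j \<Longrightarrow> A i \<inter> A j = {}"
  shows "opps (\<Union>i\<in>I. D i) = (\<Union>i\<in>I. opps (D i))"
proof -
  let ?D = "\<Union>i\<in>I. D i"
  have im: "?D `` {x} = D i `` {x}" if "i \<in> I" "x \<in> A i" for i x
  proof -
    have "j = i" if "j \<in> I" "(x, y) \<in> D j" for j y
      using disj[OF \<open>j \<in> I\<close> \<open>i \<in> I\<close>] D[OF \<open>j \<in> I\<close>] that \<open>x \<in> A i\<close> by (auto simp: complete_def)
    then show ?thesis using that by auto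
  qed
  have sub: "D i `` {x} \<subseteq> A i" if "i \<in> I" for i x
    using D[OF that] by (auto simp: complete_def)
  show ?thesis
  proof (intro set_eqI iffI)
    fix p assume "p \<in> (\<Union>i\<in>I. opps (D i))"
    then obtain i where i: "i \<in> I" "p \<in> opps (D i)" by blast
    obtain l m where lm: "p = {l, m}" "l \<noteq> {}" "m \<noteq> {}" "\<forall>x\<in>l. D i `` {x} = m"
      "\<forall>x\<in>m. D i `` {x} = l" "l \<subseteq> A i" "m \<subseteq> A i"
      by (rule oppsE[OF i(2) D[OF i(1)]], rule that)
    have "?D `` {z} = m" if "z \<in> l" for z
      using im[OF i(1) subsetD[OF lm(6) that]] bspec[OF lm(4) that] by simp
    moreover have "?D `` {z} = l" if "z \<in> m" for z
      using im[OF i(1) subsetD[OF lm(7) that]] bspec[OF lm(5) that] by simp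
    ultimately show "p \<in> opps ?D" unfolding lm(1) by (rule oppsI[OF lm(2,3)])
  next
    fix p assume p: "p \<in> opps ?D"
    have sub': "?D \<subseteq> complete (\<Union>i\<in>I. A i)"
    proof
      fix e assume "e \<in> ?D"
      then obtain i where "i \<in> I" "e \<in> D i" by blast
      then show "e \<in> complete (\<Union>i\<in>I. A i)" using D[of i] by (auto simp: complete_def)
    qed
    obtain l m where lm: "p = {l, m}" "l \<noteq> {}" "m \<noteq> {}"
      "\<forall>x\<in>l. ?D `` {x} = m" "\<forall>x\<in>m. ?D `` {x} = l"
      by (rule oppsE[OF p sub'], rule that)
    obtain x where x: "x \<in> l" using lm by blast
    then have "?D `` {x} \<noteq> {}" using lm by simp
    then obtain i y where "i \<in> I" "(x, y) \<in> D i" by auto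
    then have i: "i \<in> I" "x \<in> A i" using D[of i] by (auto simp: complete_def)
    have m: "m \<subseteq> A i" using im[OF i] sub[OF i(1), of x] bspec[OF lm(4) x] by simp
    obtain y where y: "y \<in> m" using lm by blast
    then have l: "l \<subseteq> A i"
      using im[OF i(1) subsetD[OF m y]] sub[OF i(1), of y] bspec[OF lm(5) y] by simp
    have "D i `` {z} = m" if "z \<in> l" for z
      using im[OF i(1) subsetD[OF l that]] bspec[OF lm(4) that] by simp
    moreover have "D i `` {z} = l" if "z \<in> m" for z
      using im[OF i(1) subsetD[OF m that]] bspec[OF lm(5) that] by simp
    ultimately have "p \<in> opps (D i)" unfolding lm(1) by (rule oppsI[OF lm(2,3)])
    then show "p \<in> (\<Union>i\<in>I. opps (D i))" using i(1) by blast
  qed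
qed

text \<open>Pairs from different parts are distinct, since the points of a pair form a non-empty
  subset of its part.\<close>

lemma card_opps_UN:
  assumes D: "\<And>i. i \<in> I \<Longrightarrow> D i \<subseteq> complete (A i)"
    and disj: "\<And>i j. i \<in> I \<Longrightarrow> j \<in> I \<Longrightarrow> i \<noteq> j \<Longrightarrow> A i \<inter> A j = {}"
    and fin: "finite I" "\<And>i. i \<in> I \<Longrightarrow> finite (A i)"
  shows "card (opps (\<Union>i\<in>I. D i)) = (\<Sum>i\<in>I. card (opps (D i)))"
proof -
  have "opps (D i) \<inter> opps (D j) = {}" if ij: "i \<in> I" "j \<in> I" "i \<noteq> j" for i j
  proof (rule ccontr)
    assume "\<not> ?thesis"
    then obtain p where p: "p \<in> opps (D i)" "p \<in> opps (D j)" by blast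
    show False
      using opps_Union[OF p(1) D[OF ij(1)]] opps_Union[OF p(2) D[OF ij(2)]] disj[OF ij] by blast
  qed
  moreover have "opps (\<Union>i\<in>I. D i) = (\<Union>i\<in>I. opps (D i))"
    using D disj by (rule opps_UN)
  moreover have "finite (opps (D i))" if "i \<in> I" for i
    using opps_finite[OF D fin(2)] that by blast
  ultimately show ?thesis
    using fin(1) by (simp add: card_UN_disjoint)
qed

lemma opps_Un:
  assumes "D \<subseteq> complete A" "D' \<subseteq> complete A'" "A \<inter> A' = {}" "finite A" "finite A'"
  shows "card (opps (D \<union> D')) = card (opps D) + card (opps D')"
proof -
  have "card (opps (\<Union>b\<in>UNIV. if b then D else D')) = (\<Sum>b\<in>UNIV. card (opps (if b then D else D')))"
  proof (rule card_opps_UN)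
    show "(if b then D else D') \<subseteq> complete (if b then A else A')" for b
      using assms by simp
    show "(if b then A else A') \<inter> (if c then A else A') = {}" if "b \<noteq> c" for b c
      using assms that by (cases b; cases c) auto
    show "finite (if b then A else A')" for b using assms by simp
  qed simp
  then show ?thesis by (simp add: UNIV_bool Un_commute)
qed

section \<open>Filling groups and holes\<close>

lemma fillD:
  assumes "fill A W D L"
  shows "A \<inter> W = {}" "D \<subseteq> complete A" "sym D"
    "decomp {4} (complete (A \<union> W) - complete W - D) L" "\<And>x. x \<in> A \<Longrightarrow> D `` {x} \<in> L"
  using assms unfolding fill_def by auto

lemma fill_empty: "fill {} W {} {}"
proof -
  have "complete ({} \<union> W) - complete W - {} = {}" by simp
  then show ?thesis unfolding fill_def by (simp add: sym_def)
qed

text \<open>The groups with colour in \<open>I\<close> are filled, each together with the common hole \<open>W\<close>;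
  the points \<open>Z\<close> of the remaining group join the hole.\<close>

lemma fill_groups:
  fixes c :: "'a \<Rightarrow> 'b"
  assumes d: "decomp {4} {(x, y). x \<in> X \<and> y \<in> X \<and> c x \<noteq> c y} L0"
    and f: "\<And>i. i \<in> I \<Longrightarrow> fill {x \<in> X. c x = i} W (D i) (L i)"
    and Z: "\<And>x y. x \<in> X \<Longrightarrow> y \<in> X \<Longrightarrow> c x \<notin> I \<Longrightarrow> c y \<notin> I \<Longrightarrow> c x = c y"
    and W: "X \<inter> W = {}"
  shows "fill {x \<in> X. c x \<in> I} (W \<union> {x \<in> X. c x \<notin> I}) (\<Union>i\<in>I. D i) (L0 \<union> (\<Union>i\<in>I. L i))"
proof -
  let ?A = "{x \<in> X. c x \<in> I}" and ?Z = "{x \<in> X. c x \<notin> I}"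
  let ?g = "\<lambda>i. {x \<in> X. c x = i}"
  let ?E = "\<lambda>i. complete (?g i \<union> W) - complete W - D i"
  have D: "x \<in> X \<and> y \<in> X \<and> c x = i \<and> c y = i \<and> x \<noteq> y" if "i \<in> I" "(x, y) \<in> D i" for i x y
    using fillD(2)[OF f[OF that(1)]] that(2) by (auto simp: complete_def)
  have DU: "(x, y) \<in> (\<Union>i\<in>I. D i) \<longleftrightarrow> c x \<in> I \<and> (x, y) \<in> D (c x)" for x y
  proof
    assume "(x, y) \<in> (\<Union>i\<in>I. D i)"
    then obtain i where "i \<in> I" "(x, y) \<in> D i" by blast
    then show "c x \<in> I \<and> (x, y) \<in> D (c x)" using D[of i x y] by simp
  qed blast
  have Eiff: "(x, y) \<in> ?E i \<longleftrightarrow> x \<noteq> y \<and> (x, y) \<notin> D i \<and> (x \<in> ?g i \<and> y \<in> ?g i \<or> x \<in> ?g i \<and> y \<in> W \<or> x \<in> W \<and> y \<in> ?g i)"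
    if "i \<in> I" for x y i
    using W by (auto simp: complete_def)
  have 1: "decomp {4} (\<Union>i\<in>I. ?E i) (\<Union>i\<in>I. L i)"
  proof (rule decomp_UN)
    show "decomp {4} (?E i) (L i)" if "i \<in> I" for i by (rule fillD(4)[OF f[OF that]])
    \<comment> \<open>Two filled groups share only points of \<open>W\<close>, and the edges inside
      \<open>W\<close> are removed from both.\<close>
    show "?E i \<inter> ?E j = {}" if ij: "i \<in> I" "j \<in> I" "i \<noteq> j" for i j
    proof -
      have "\<not> ((x, y) \<in> ?E i \<and> (x, y) \<in> ?E j)" for x y
        unfolding Eiff[OF ij(1)] Eiff[OF ij(2)] using ij(3) W by auto
      then show ?thesis by auto
    qed
  qed
  have 2: "{(x, y). x \<in> X \<and> y \<in> X \<and> c x \<noteq> c y} \<inter> (\<Union>i\<in>I. ?E i) = {}"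
  proof -
    have "\<not> (i \<in> I \<and> (x, y) \<in> ?E i \<and> x \<in> X \<and> y \<in> X \<and> c x \<noteq> c y)" for x y i
      using Eiff[of i x y] W by auto
    then show ?thesis by auto
  qed
  \<comment> \<open>An edge outside the enlarged hole joins two groups, or lies in a filled group,
    or joins a filled group to \<open>W\<close>. By \<open>Z\<close> the unfilled points belong to a
    single group, so no edge of the group divisible design falls into the enlarged hole.\<close>
  have 3: "{(x, y). x \<in> X \<and> y \<in> X \<and> c x \<noteq> c y} \<union> (\<Union>i\<in>I. ?E i)
    = complete (?A \<union> (W \<union> ?Z)) - complete (W \<union> ?Z) - (\<Union>i\<in>I. D i)"
  proof -
    have "(x \<in> X \<and> y \<in> X \<and> c x \<noteq> c y) \<or> (\<exists>i\<in>I. (x, y) \<in> ?E i) \<longleftrightarrow>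
      (x, y) \<in> complete (?A \<union> (W \<union> ?Z)) \<and> (x, y) \<notin> complete (W \<union> ?Z) \<and> (x, y) \<notin> (\<Union>i\<in>I. D i)" for x y
    proof -
      have e: "(\<exists>i\<in>I. (x, y) \<in> ?E i) \<longleftrightarrow> x \<noteq> y \<and>
        (x \<in> X \<and> y \<in> X \<and> c x = c y \<and> c x \<in> I \<and> (x, y) \<notin> D (c x) \<or> x \<in> X \<and> c x \<in> I \<and> y \<in> W
          \<or> x \<in> W \<and> y \<in> X \<and> c y \<in> I)" (is "?l \<longleftrightarrow> ?r")
      proof
        assume ?l
        then obtain i where i: "i \<in> I" "(x, y) \<in> ?E i" by blast
        then show ?r using Eiff[OF i(1), of x y] by auto
      next
        assume r: ?r
        then consider "c x \<in> I" "(x, y) \<in> ?E (c x)" | "c y \<in> I" "(x, y) \<in> ?E (c y)"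
        proof (elim conjE disjE)
          assume "x \<noteq> y" "x \<in> X" "y \<in> X" "c x = c y" "c x \<in> I" "(x, y) \<notin> D (c x)"
          then show thesis using that(1) Eiff[of "c x" x y] by simp
        next
          assume *: "x \<noteq> y" "x \<in> X" "c x \<in> I" "y \<in> W"
          then have "(x, y) \<notin> D (c x)" using D[of "c x" x y] W by auto
          then show thesis using * that(1) Eiff[of "c x" x y] by simp
        next
          assume *: "x \<noteq> y" "y \<in> X" "c y \<in> I" "x \<in> W"
          then have "(x, y) \<notin> D (c y)" using D[of "c y" x y] W by auto
          then show thesis using * that(2) Eiff[of "c y" x y] by simp
        qed
        then show ?l by blast
      qed
      have mem: "(x, y) \<in> complete S \<longleftrightarrow> x \<in> S \<and> y \<in> S \<and> x \<noteq> y" for S :: "'a set"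
        by (simp add: complete_def)
      have w: "x \<in> X \<Longrightarrow> x \<notin> W" "y \<in> X \<Longrightarrow> y \<notin> W" using W by auto
      have z: "x \<in> X \<Longrightarrow> y \<in> X \<Longrightarrow> c x \<notin> I \<Longrightarrow> c y \<notin> I \<Longrightarrow> c x = c y" by (rule Z)
      have i: "c x = c y \<Longrightarrow> c x \<in> I \<longleftrightarrow> c y \<in> I" "x = y \<Longrightarrow> c x = c y" "x = y \<Longrightarrow> x \<in> X \<longleftrightarrow> y \<in> X" by auto
      have d: "c x \<in> I \<Longrightarrow> (x, y) \<in> D (c x) \<Longrightarrow> x \<in> X \<and> y \<in> X \<and> c x = c y"
        using D[of "c x" x y] by simp
      show ?thesis
        unfolding e DU mem Un_iff mem_Collect_eq using w z i d by argo
    qed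
    then have "((x, y) \<in> {(x, y). x \<in> X \<and> y \<in> X \<and> c x \<noteq> c y} \<union> (\<Union>i\<in>I. ?E i)) \<longleftrightarrow>
      (x, y) \<in> complete (?A \<union> (W \<union> ?Z)) - complete (W \<union> ?Z) - (\<Union>i\<in>I. D i)" for x y
      by (simp only: Un_iff UN_iff Diff_iff mem_Collect_eq prod.case conj_assoc)
    then show ?thesis by (intro set_eqI) (rule prod.exhaust, erule ssubst)
  qed
  have "decomp {4} (complete (?A \<union> (W \<union> ?Z)) - complete (W \<union> ?Z) - (\<Union>i\<in>I. D i)) (L0 \<union> (\<Union>i\<in>I. L i))"
    using decomp_Un[OF d 1 2] unfolding 3 .
  moreover have "(\<Union>i\<in>I. D i) `` {x} \<in> L0 \<union> (\<Union>i\<in>I. L i)" if x: "x \<in> ?A" for x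
  proof -
    have "(\<Union>i\<in>I. D i) `` {x} = D (c x) `` {x}" using DU[of x] x by auto
    moreover have "D (c x) `` {x} \<in> L (c x)" using fillD(5)[OF f, of "c x" x] x by simp
    ultimately show ?thesis using x by auto
  qed
  moreover have "sym (\<Union>i\<in>I. D i)"
    using fillD(3)[OF f] by (auto intro!: sym_UNION)
  moreover have "(\<Union>i\<in>I. D i) \<subseteq> complete ?A" using D by (auto simp: complete_def)
  moreover have "?A \<inter> (W \<union> ?Z) = {}" using W by auto
  ultimately show ?thesis unfolding fill_def by blast
qed

text \<open>\<open>D\<close> lives on \<open>A\<close> and \<open>D'\<close> on \<open>W\<close>, so
  each point keeps the neighbourhood that it has in its own part, and the edges missing inside the
  hole are supplied by the second structure.\<close>

lemma fill_plug:
  assumes "fill A W D L" "fill W {} D' L'"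
  shows "fill (A \<union> W) {} (D \<union> D') (L \<union> L')"
proof -
  note f = fillD[OF assms(1)] fillD[OF assms(2)]
  have 1: "complete (A \<union> W \<union> {}) - complete {} - (D \<union> D')
    = (complete (A \<union> W) - complete W - D) \<union> (complete (W \<union> {}) - complete {} - D')"
  proof -
    have "D \<inter> complete W = {}" using f(1,2) by (auto simp: complete_def)
    moreover have "complete W \<subseteq> complete (A \<union> W)" "complete {} = {}" by (auto simp: complete_def)
    ultimately show ?thesis using f(7) by auto
  qed
  have 2: "(complete (A \<union> W) - complete W - D) \<inter> (complete (W \<union> {}) - complete {} - D') = {}" by auto
  have 3: "decomp {4} (complete (A \<union> W \<union> {}) - complete {} - (D \<union> D')) (L \<union> L')"
    unfolding 1 by (rule decomp_Un[OF f(4,9) 2])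
  have 4: "(D \<union> D') `` {x} \<in> L \<union> L'" if "x \<in> A \<union> W" for x
  proof (cases "x \<in> A")
    case True
    then have "D' `` {x} = {}" using f(1,7) by (auto simp: complete_def)
    then have "(D \<union> D') `` {x} = D `` {x}" by auto
    then show ?thesis using f(5)[OF True] by simp
  next
    case False
    then have "D `` {x} = {}" using f(2) by (auto simp: complete_def)
    then have "(D \<union> D') `` {x} = D' `` {x}" by auto
    then show ?thesis using f(10)[of x] False that by simp
  qed
  have 5: "D \<union> D' \<subseteq> complete (A \<union> W)" using f(2,7) by (auto simp: complete_def)
  have 6: "sym (D \<union> D')" using f(3,8) by (rule sym_Un)
  show ?thesis unfolding fill_def using 3 4 5 6 by simp
qed

section \<open>Relabelling the points\<close>

lemma Image_map_prod:
  assumes D: "D \<subseteq> complete A" and inj: "inj_on f A" and x: "x \<in> A"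
  shows "(map_prod f f ` D) `` {f x} = f ` (D `` {x})"
proof (rule set_eqI)
  fix b
  have "(f x, b) \<in> map_prod f f ` D \<longleftrightarrow> b \<in> f ` (D `` {x})"
  proof
    assume "(f x, b) \<in> map_prod f f ` D"
    then obtain y z where yz: "(y, z) \<in> D" "f x = f y" "b = f z" by auto
    then have "y \<in> A" using D by (auto simp: complete_def)
    then have "y = x" using inj_onD[OF inj yz(2)] x by simp
    then show "b \<in> f ` (D `` {x})" using yz by auto
  next
    assume "b \<in> f ` (D `` {x})"
    then show "(f x, b) \<in> map_prod f f ` D" by (auto intro: rev_image_eqI)
  qed
  then show "b \<in> (map_prod f f ` D) `` {f x} \<longleftrightarrow> b \<in> f ` (D `` {x})" by simp
qed

lemma fill_image:
  assumes f: "fill A W D L" and inj: "inj_on f (A \<union> W)"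
  shows "fill (f ` A) (f ` W) (map_prod f f ` D) ((`) f ` L)"
proof -
  note F = fillD[OF f]
  let ?S = "A \<union> W"
  have cmp: "map_prod f f ` complete S = complete (f ` S)" if "S \<subseteq> ?S" for S
    using inj_on_subset[OF inj that] by (auto simp: complete_def inj_on_def image_iff)
  have inj2: "inj_on (map_prod f f) (?S \<times> ?S)"
    using map_prod_inj_on[OF inj inj] .
  have sub: "complete ?S \<subseteq> ?S \<times> ?S" "complete W \<subseteq> ?S \<times> ?S" "D \<subseteq> ?S \<times> ?S"
    using F(2) by (auto simp: complete_def)
  have "map_prod f f ` (complete ?S - complete W - D)
      = map_prod f f ` complete ?S - map_prod f f ` complete W - map_prod f f ` D"
  proof -
    have s: "complete ?S - complete W \<subseteq> ?S \<times> ?S" "complete ?S - complete W - D \<subseteq> ?S \<times> ?S"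
      using sub(1) by blast+
    show ?thesis
      by (simp only: inj_on_image_set_diff[OF inj2 s(2) sub(3)] inj_on_image_set_diff[OF inj2 s(1) sub(2)])
  qed
  then have "map_prod f f ` (complete ?S - complete W - D)
      = complete (f ` A \<union> f ` W) - complete (f ` W) - map_prod f f ` D"
    by (simp add: cmp image_Un)
  moreover have "decomp {4} (map_prod f f ` (complete ?S - complete W - D)) ((`) f ` L)"
    by (rule decomp_image[OF F(4) _ inj]) (use sub(1) in blast)
  moreover have "(map_prod f f ` D) `` {f x} = f ` (D `` {x})" if "x \<in> A" for x
    by (rule Image_map_prod[OF F(2) inj_on_subset[OF inj] that]) simp
  then have "(map_prod f f ` D) `` {y} \<in> (`) f ` L" if "y \<in> f ` A" for y
    using that F(5) by auto
  moreover have "sym (map_prod f f ` D)"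
    using F(3) by (auto simp: sym_def intro: rev_image_eqI)
  moreover have "map_prod f f ` D \<subseteq> complete (f ` A)"
    using F(2) cmp[of A] by auto
  moreover have "f ` A \<inter> f ` W = {}"
    using F(1) inj_on_image_Int[OF inj, of A W] by simp
  ultimately show ?thesis unfolding fill_def by metis
qed

lemma opps_image:
  assumes D: "D \<subseteq> complete A" and inj: "inj_on f A"
  shows "opps (map_prod f f ` D) = (`) ((`) f) ` opps D"
proof -
  let ?D = "map_prod f f ` D"
  have im: "?D `` {f x} = f ` (D `` {x})" if "x \<in> A" for x
    by (rule Image_map_prod[OF D inj that])
  have sub: "D `` {x} \<subseteq> A" for x using D by (auto simp: complete_def)
  have D': "?D \<subseteq> complete (f ` A)"
    using D inj by (auto simp: complete_def inj_on_def)
  show ?thesis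
  proof (intro set_eqI iffI)
    fix p assume "p \<in> (`) ((`) f) ` opps D"
    then obtain q where q: "q \<in> opps D" "p = (`) f ` q" by blast
    obtain l m where lm: "q = {l, m}" "l \<noteq> {}" "m \<noteq> {}" "\<forall>x\<in>l. D `` {x} = m" "\<forall>x\<in>m. D `` {x} = l"
      "l \<subseteq> A" "m \<subseteq> A"
      by (rule oppsE[OF q(1) D], rule that)
    have h1: "?D `` {f x} = f ` m" if "x \<in> l" for x
      using im[OF subsetD[OF lm(6) that]] bspec[OF lm(4) that] by simp
    have h2: "?D `` {f x} = f ` l" if "x \<in> m" for x
      using im[OF subsetD[OF lm(7) that]] bspec[OF lm(5) that] by simp
    have "{f ` l, f ` m} \<in> opps ?D"
      using lm(2,3) by (intro oppsI; (elim imageE)?; simp add: h1 h2)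
    then show "p \<in> opps ?D" using q(2) lm(1) by simp
  next
    fix p assume p: "p \<in> opps ?D"
    obtain l' m' where lm: "p = {l', m'}" "l' \<noteq> {}" "m' \<noteq> {}" "\<forall>x\<in>l'. ?D `` {x} = m'" "\<forall>x\<in>m'. ?D `` {x} = l'"
      "l' \<subseteq> f ` A" "m' \<subseteq> f ` A"
      by (rule oppsE[OF p D'], rule that)
    obtain l m where l: "l' = f ` l" "l \<subseteq> A" and m: "m' = f ` m" "m \<subseteq> A"
      using lm(6,7) unfolding subset_image_iff by blast
    have h1: "D `` {x} = m" if x: "x \<in> l" for x
    proof -
      have "f ` (D `` {x}) = f ` m"
        using im[OF subsetD[OF l(2) x]] bspec[OF lm(4), of "f x"] l(1) m(1) x by simp
      then show ?thesis using inj_on_image_eq_iff[OF inj sub m(2)] by simp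
    qed
    have h2: "D `` {x} = l" if x: "x \<in> m" for x
    proof -
      have "f ` (D `` {x}) = f ` l"
        using im[OF subsetD[OF m(2) x]] bspec[OF lm(5), of "f x"] l(1) m(1) x by simp
      then show ?thesis using inj_on_image_eq_iff[OF inj sub l(2)] by simp
    qed
    have "{l, m} \<in> opps D"
      by (rule oppsI[OF _ _ h1 h2]) (use lm(2,3) l m in simp_all)
    then show "p \<in> (`) ((`) f) ` opps D" using lm(1) l m by (auto intro!: rev_image_eqI[of "{l, m}"])
  qed
qed

lemma card_opps_image:
  assumes D: "D \<subseteq> complete A" and inj: "inj_on f A"
  shows "card (opps (map_prod f f ` D)) = card (opps D)"
  unfolding opps_image[OF assms]
proof (rule card_image)
  have "inj_on ((`) ((`) f)) (Pow (Pow A))"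
    by (intro inj_on_image_Pow inj)
  moreover have "opps D \<subseteq> Pow (Pow A)" using opps_Union(1)[OF _ D] by blast
  ultimately show "inj_on ((`) ((`) f)) (opps D)" by (rule inj_on_subset)
qed

text \<open>A point other than \<open>x\<close> is non-collinear with \<open>x\<close> exactly if it
  is a \<open>D\<close>-neighbour, so \<open>opp\<close> gives the neighbourhood. For the degree,
  the lines through \<open>x\<close> without \<open>x\<close> are disjoint triples covering all
  points except \<open>x\<close> and its four neighbours, \<open>3 * r\<close> points in
  all.\<close>

lemma fill_PENT:
  fixes A :: "'a set"
  assumes f: "fill A {} D L" and fin: "finite A" and cardA: "card A = 3 * r + 5" and r: "1 \<le> r"
  shows "PENT 4 r A L" and "opposite_line_pairs A L = opps D"
proof -
  define E where "E = complete A - D"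
  have "complete ({} :: 'a set) = {}" by (simp add: complete_def)
  then have d: "decomp {4} E L" using fillD(4)[OF f] by (simp add: E_def)
  have Dsub: "D \<subseteq> complete A" and nb: "\<And>x. x \<in> A \<Longrightarrow> D `` {x} \<in> L"
    using fillD(2,5)[OF f] by blast+
  have sub: "B \<subseteq> A" if "B \<in> L" for B
    by (rule decomp_block_subset[OF d _ that]) (auto simp: E_def complete_def)
  have c4: "card B = 4" if "B \<in> L" for B using decompD(1)[OF d that] by simp
  have E: "(x, y) \<in> E \<longleftrightarrow> x \<noteq> y \<and> (\<exists>B\<in>L. x \<in> B \<and> y \<in> B)" for x y
  proof
    show "x \<noteq> y \<and> (\<exists>B\<in>L. x \<in> B \<and> y \<in> B)" if "(x, y) \<in> E"
      using decompD(5,6)[OF d that] by blast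
    show "(x, y) \<in> E" if *: "x \<noteq> y \<and> (\<exists>B\<in>L. x \<in> B \<and> y \<in> B)"
    proof -
      obtain B where "B \<in> L" "x \<in> B" "y \<in> B" using * by blast
      then show ?thesis using decompD(4)[OF d] * by blast
    qed
  qed
  have opp: "opp A L x = D `` {x}" if x: "x \<in> A" for x
  proof -
    have "y \<in> A \<and> y \<noteq> x \<and> (x, y) \<notin> E \<longleftrightarrow> (x, y) \<in> D" for y
      using x Dsub by (auto simp: E_def complete_def)
    then show ?thesis unfolding opp_def collinear_def E[symmetric] by auto
  qed
  have deg: "card {l \<in> L. x \<in> l} = r" if x: "x \<in> A" for x
  proof -
    let ?T = "{l \<in> L. x \<in> l}"
    have "L \<subseteq> Pow A" using sub by blast
    then have finT: "finite ?T" using fin finite_subset by fastforce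
    have "card (\<Union>l\<in>?T. l - {x}) = (\<Sum>l\<in>?T. card (l - {x}))"
    proof (rule card_UN_disjoint)
      show "\<forall>l\<in>?T. \<forall>m\<in>?T. l \<noteq> m \<longrightarrow> (l - {x}) \<inter> (m - {x}) = {}"
      proof (intro ballI impI)
        fix l m assume lm: "l \<in> ?T" "m \<in> ?T" "l \<noteq> m"
        show "(l - {x}) \<inter> (m - {x}) = {}"
        proof (rule ccontr)
          assume "\<not> ?thesis"
          then obtain y where y: "y \<in> l" "y \<in> m" "x \<noteq> y" by blast
          then have "(x, y) \<in> E" using E lm by blast
          then show False using decompD(7)[OF d, of x y l m] lm y by simp
        qed
      qed
    qed (use finT decompD(3)[OF d] in auto)
    also have "\<dots> = (\<Sum>l\<in>?T. 3)"
    proof (rule sum.cong[OF refl])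
      fix l assume "l \<in> ?T"
      then show "card (l - {x}) = 3" using c4[of l] decompD(3)[OF d, of l] by simp
    qed
    also have "(\<Union>l\<in>?T. l - {x}) = A - {x} - D `` {x}"
    proof -
      have "y \<in> (\<Union>l\<in>?T. l - {x}) \<longleftrightarrow> (x, y) \<in> E" for y unfolding E by blast
      moreover have "y \<in> A - {x} - D `` {x} \<longleftrightarrow> (x, y) \<in> E" for y
        using x by (auto simp: E_def complete_def)
      ultimately show ?thesis by blast
    qed
    also have "card (A - {x} - D `` {x}) = 3 * r"
    proof -
      have "D `` {x} \<subseteq> A - {x}" using Dsub by (auto simp: complete_def)
      moreover have "card (D `` {x}) = 4" using c4[OF nb[OF x]] .
      moreover have "card (A - {x}) = 3 * r + 4" using cardA x fin by simp
      ultimately show ?thesis using fin by (simp add: card_Diff_subset finite_subset)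
    qed
    finally show ?thesis by simp
  qed
  show P: "PENT 4 r A L"
  proof
    show "A \<noteq> {}" using cardA by auto
    show "finite A" by (rule fin)
    show "l \<subseteq> A" "2 \<le> card l" "card l = 4" if "l \<in> L" for l using sub[OF that] c4[OF that] by auto
    show "l = m" if "x \<noteq> y" "l \<in> L" "m \<in> L" "x \<in> l" "y \<in> l" "x \<in> m" "y \<in> m" for x y l m
      using decompD(7)[OF d, of x y l m] E[of x y] that by blast
    show "card {l \<in> L. x \<in> l} = r" if "x \<in> A" for x by (rule deg[OF that])
    show "opp A L x \<in> L" if "x \<in> A" for x using opp[OF that] nb[OF that] by simp
  qed (use r in simp_all)
  show "opposite_line_pairs A L = opps D"
  proof (intro set_eqI iffI)
    fix p assume "p \<in> opposite_line_pairs A L"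
    then obtain l m where lm: "p = {l, m}" "l \<in> L" "m \<in> L" "\<forall>x\<in>l. opp A L x = m" "\<forall>x\<in>m. opp A L x = l"
      unfolding opposite_line_pairs_def by (elim CollectE exE conjE) (rule that)
    have "l \<noteq> {}" "m \<noteq> {}" using c4[OF lm(2)] c4[OF lm(3)] by auto
    moreover have "D `` {x} = m" if "x \<in> l" for x
      using opp[of x] sub[OF lm(2)] bspec[OF lm(4) that] that by auto
    moreover have "D `` {x} = l" if "x \<in> m" for x
      using opp[of x] sub[OF lm(3)] bspec[OF lm(5) that] that by auto
    ultimately show "p \<in> opps D" unfolding lm(1) by (rule oppsI)
  next
    fix p assume p: "p \<in> opps D"
    obtain l m where lm: "p = {l, m}" "l \<noteq> {}" "m \<noteq> {}" "\<forall>x\<in>l. D `` {x} = m" "\<forall>x\<in>m. D `` {x} = l"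
      "l \<subseteq> A" "m \<subseteq> A" "l \<inter> m = {}"
      by (rule oppsE[OF p Dsub], rule that)
    obtain x y where xy: "x \<in> l" "y \<in> m" using lm(2,3) by blast
    \<comment> \<open>\<open>opps\<close> does not mention lines: each side is a line because it is
      the neighbourhood of a point on the other side.\<close>
    have "m \<in> L" using nb[of x] bspec[OF lm(4) xy(1)] lm(6) xy(1) by auto
    moreover have "l \<in> L" using nb[of y] bspec[OF lm(5) xy(2)] lm(7) xy(2) by auto
    moreover have "\<forall>x\<in>l. opp A L x = m"
    proof
      fix x assume "x \<in> l"
      then show "opp A L x = m" using opp[of x] bspec[OF lm(4), of x] lm(6) by auto
    qed
    moreover have "\<forall>x\<in>m. opp A L x = l"
    proof
      fix x assume "x \<in> m"
      then show "opp A L x = l" using opp[of x] bspec[OF lm(5), of x] lm(7) by auto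
    qed
    moreover have "disjnt l m" using lm(8) by (simp add: disjnt_def)
    ultimately show "p \<in> opposite_line_pairs A L"
      unfolding opposite_line_pairs_def lm(1) by (intro CollectI exI[of _ l] exI[of _ m]) simp
  qed
qed

section \<open>Existence in terms of sizes\<close>

definition holey :: "nat \<Rightarrow> nat \<Rightarrow> bool" where
  "holey w v \<longleftrightarrow> (\<exists>(A :: int set) W D L. finite A \<and> finite W \<and> card A = v \<and> card W = w \<and>
    fill A W D L \<and> opps D = {})"

definition penta :: "nat \<Rightarrow> nat \<Rightarrow> bool" where
  "penta v j \<longleftrightarrow> (\<exists>(A :: int set) D L. finite A \<and> card A = v \<and> fill A {} D L \<and> card (opps D) = j)"

text \<open>Finite point sets of any type can be moved into the integers, so \<open>holey\<close>
  and \<open>penta\<close> can be statements about sizes alone.\<close>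

lemma ex_inj_int:
  fixes S :: "'a set"
  assumes "finite S"
  shows "\<exists>f :: 'a \<Rightarrow> int. inj_on f S"
proof -
  obtain h where "bij_betw h S {0..<card S}" using ex_bij_betw_finite_nat[OF assms] by blast
  then have "inj_on (int \<circ> h) S" by (auto simp: bij_betw_def inj_on_def)
  then show ?thesis by blast
qed

lemma holeyI:
  assumes f: "fill A W D L" and fin: "finite A" "finite W" and D: "opps D = {}"
  shows "holey (card W) (card A)"
proof -
  obtain f :: "'a \<Rightarrow> int" where inj: "inj_on f (A \<union> W)" using ex_inj_int[of "A \<union> W"] fin by auto
  have "inj_on f A" "inj_on f W" using inj by (auto intro: inj_on_subset)
  moreover have "opps (map_prod f f ` D) = {}"
    using opps_image[OF fillD(2)[OF f]] \<open>inj_on f A\<close> D by simp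
  ultimately show ?thesis unfolding holey_def
    using fill_image[OF f inj] fin by (intro exI[of _ "f ` A"] exI[of _ "f ` W"]) (auto simp: card_image)
qed

lemma pentaI:
  assumes f: "fill A {} D L" and fin: "finite A"
  shows "penta (card A) (card (opps D))"
proof -
  obtain f :: "'a \<Rightarrow> int" where inj: "inj_on f A" using ex_inj_int[OF fin] by blast
  show ?thesis unfolding penta_def
    using fill_image[OF f] inj fin card_opps_image[OF fillD(2)[OF f] inj]
    by (intro exI[of _ "f ` A"]) (auto simp: card_image)
qed

text \<open>Bijections on \<open>A0\<close> and on \<open>W0\<close> are glued, so the structure can
  be placed on prescribed sets. This allows several groups to be filled around one common
  hole.\<close>

lemma holey_fill:
  fixes A W :: "'a set"
  assumes h: "holey (card W) (card A)" and fin: "finite A" "finite W" and AW: "A \<inter> W = {}"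
  shows "\<exists>D L. fill A W D L \<and> opps D = {}"
proof -
  obtain A0 W0 :: "int set" and D L where 0: "finite A0" "finite W0" "card A0 = card A" "card W0 = card W"
    "fill A0 W0 D L" "opps D = {}"
    using h unfolding holey_def by blast
  obtain f where f: "bij_betw f A0 A" using finite_same_card_bij[OF 0(1) fin(1) 0(3)] by blast
  obtain g where g: "bij_betw g W0 W" using finite_same_card_bij[OF 0(2) fin(2) 0(4)] by blast
  define h where "h x = (if x \<in> A0 then f x else g x)" for x
  have dis: "A0 \<inter> W0 = {}" by (rule fillD(1)[OF 0(5)])
  have hA: "bij_betw h A0 A"
    using f by (rule bij_betw_cong[THEN iffD1, rotated]) (simp add: h_def)
  have hW: "bij_betw h W0 W"
    using g by (rule bij_betw_cong[THEN iffD1, rotated]) (use dis in \<open>auto simp: h_def\<close>)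
  have "bij_betw h (A0 \<union> W0) (A \<union> W)" by (rule bij_betw_combine[OF hA hW AW])
  then have inj: "inj_on h (A0 \<union> W0)" by (rule bij_betw_imp_inj_on)
  have "fill A W (map_prod h h ` D) ((`) h ` L)"
    using fill_image[OF 0(5) inj] hA hW by (simp add: bij_betw_def)
  moreover have "opps (map_prod h h ` D) = {}"
    using opps_image[OF fillD(2)[OF 0(5)] bij_betw_imp_inj_on[OF hA]] 0(6) by simp
  ultimately show ?thesis by blast
qed

lemma penta_fill:
  fixes A :: "'a set"
  assumes h: "penta (card A) j" and fin: "finite A"
  shows "\<exists>D L. fill A {} D L \<and> card (opps D) = j"
proof -
  obtain A0 :: "int set" and D L where 0: "finite A0" "card A0 = card A" "fill A0 {} D L" "card (opps D) = j"
    using h unfolding penta_def by blast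
  obtain f where f: "bij_betw f A0 A" using finite_same_card_bij[OF 0(1) fin 0(2)] by blast
  then have inj: "inj_on f A0" by (rule bij_betw_imp_inj_on)
  have "fill A {} (map_prod f f ` D) ((`) f ` L)"
    using fill_image[OF 0(3), of f] f inj by (simp add: bij_betw_def)
  then show ?thesis using card_opps_image[OF fillD(2)[OF 0(3)] inj] 0(4) by metis
qed

lemma penta_PENT:
  assumes "penta (3 * r + 5) j" "1 \<le> r"
  shows "\<exists>(V :: nat set) L. PENT 4 r V L \<and> card (opposite_line_pairs V L) = j"
proof -
  obtain D L where "fill {..<3 * r + 5} {} D L" "card (opps D) = j"
    using penta_fill[of "{..<3 * r + 5}" j] assms(1) by auto
  then show ?thesis using fill_PENT[of "{..<3 * r + 5}" D L r] assms(2)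
    by (intro exI[of _ "{..<3 * r + 5}"] exI[of _ L]) simp
qed

lemma opps_empty [simp]: "opps {} = {}"
proof -
  have False if "p \<in> opps {}" for p :: "'a set set"
    by (rule oppsE[OF that, of "{}"]) auto
  then show ?thesis by blast
qed

text \<open>A group truncated to nothing is filled trivially, so truncated group sizes may be
  \<open>0\<close>.\<close>

lemma holey_0: "holey w 0"
  using holeyI[OF fill_empty, of "int ` {..<w}"] by (simp add: card_image)

section \<open>Recursive constructions\<close>

lemma holey_penta:
  assumes "holey w v" "penta w j"
  shows "penta (v + w) j"
proof -
  obtain A W :: "int set" and D L where 0: "finite A" "finite W" "card A = v" "card W = w"
    "fill A W D L" "opps D = {}"
    using assms(1) unfolding holey_def by blast
  obtain D' L' where 1: "fill W {} D' L'" "card (opps D') = j"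
    using penta_fill[of W j] assms(2) 0 by auto
  note AW = fillD(1)[OF 0(5)]
  have "card (opps (D \<union> D')) = j"
    using opps_Un[OF fillD(2)[OF 0(5)] fillD(2)[OF 1(1)] AW 0(1,2)] 0(6) 1(2) by simp
  then show ?thesis
    using pentaI[OF fill_plug[OF 0(5) 1(1)]] 0 AW by (simp add: card_Un_disjoint)
qed

text \<open>All groups are filled, with an empty hole. The deficiency graphs sit on disjoint groups,
  so their numbers of opposite pairs add.\<close>

lemma penta_mult:
  assumes g: "gdd {4} v s" and p: "\<And>i. i < s \<Longrightarrow> penta v (f i)"
  shows "penta (s * v) (\<Sum>i<s. f i)"
proof -
  let ?X = "{..<s} \<times> {..<v}"
  obtain L0 where L0: "decomp {4} (blow (complete {..<s}) {..<v}) L0" using g by (auto simp: gdd_def)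
  have eq: "blow (complete {..<s}) {..<v} = {(x, y). x \<in> ?X \<and> y \<in> ?X \<and> fst x \<noteq> fst y}"
    by (auto simp: blow_def complete_def)
  have grp: "{x \<in> ?X. fst x = i} = Pair i ` {..<v}" if "i < s" for i using that by auto
  have "\<exists>D L. fill {x \<in> ?X. fst x = i} {} D L \<and> card (opps D) = f i" if "i < s" for i
    using penta_fill[of "{x \<in> ?X. fst x = i}" "f i"] p[OF that] unfolding grp[OF that]
    by (simp add: card_image inj_on_def)
  then have "\<forall>i. \<exists>D L. i < s \<longrightarrow> fill {x \<in> ?X. fst x = i} {} D L \<and> card (opps D) = f i"
    by blast
  then obtain D L where "\<forall>i. i < s \<longrightarrow> fill {x \<in> ?X. fst x = i} {} (D i) (L i) \<and> card (opps (D i)) = f i"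
    unfolding choice_iff by (elim exE) (rule that)
  then have DL: "fill {x \<in> ?X. fst x = i} {} (D i) (L i)" "card (opps (D i)) = f i" if "i < s" for i
    using that by simp_all
  have F: "fill {x \<in> ?X. fst x \<in> {..<s}} ({} \<union> {x \<in> ?X. fst x \<notin> {..<s}}) (\<Union>i\<in>{..<s}. D i) (L0 \<union> (\<Union>i\<in>{..<s}. L i))"
  proof (rule fill_groups[OF L0[unfolded eq]])
    show "fill {x \<in> ?X. fst x = i} {} (D i) (L i)" if "i \<in> {..<s}" for i using DL(1) that by simp
  qed auto
  have "{x \<in> ?X. fst x \<in> {..<s}} = ?X" "{} \<union> {x \<in> ?X. fst x \<notin> {..<s}} = {}" by auto
  with F have F': "fill ?X {} (\<Union>i\<in>{..<s}. D i) (L0 \<union> (\<Union>i\<in>{..<s}. L i))" by (simp only:)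
  have "card (opps (\<Union>i\<in>{..<s}. D i)) = (\<Sum>i\<in>{..<s}. card (opps (D i)))"
  proof (rule card_opps_UN)
    show "D i \<subseteq> complete {x \<in> ?X. fst x = i}" if "i \<in> {..<s}" for i
      using fillD(2)[OF DL(1)] that by simp
  qed auto
  also have "\<dots> = (\<Sum>i<s. f i)" using DL(2) by (intro sum.cong) auto
  finally show ?thesis using pentaI[OF F'] by (simp add: card_cartesian_product)
qed

text \<open>Each block of the transversal design meets each group once. The first four groups stay
  complete, so truncated blocks keep between \<open>4\<close> and \<open>k\<close> points, and for
  these sizes designs of weight \<open>g\<close> are given.\<close>

lemma decomp_truncated:
  assumes td: "gdd {k} n k" and n: "\<And>i. i < k \<Longrightarrow> a i \<le> n" "\<And>i. i < 4 \<Longrightarrow> a i = n" and k: "4 \<le> k"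
    and g: "\<And>s. 4 \<le> s \<Longrightarrow> s \<le> k \<Longrightarrow> gdd {4} g s"
    and X: "X = (SIGMA i:{..<k}. {..<a i}) \<times> {..<g}"
  shows "\<exists>L. decomp {4} {(x, y). x \<in> X \<and> y \<in> X \<and> fst (fst x) \<noteq> fst (fst y)} L"
proof -
  define S where "S = (SIGMA i:{..<k}. {..<a i})"
  obtain L where L: "decomp {k} (blow (complete {..<k}) {..<n}) L" using td by (auto simp: gdd_def)
  have card: "card (B \<inter> S) \<in> {4..k}" if B: "B \<in> L" for B
  proof -
    have cB: "card B = k" and fB: "finite B" using decompD(1,3)[OF L B] by auto
    have sub: "B \<subseteq> {..<k} \<times> {..<n}"
      by (rule decomp_block_subset[OF L _ B]) (auto simp: blow_def complete_def)
    have inj: "inj_on fst B"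
    proof (rule inj_onI)
      fix x y assume xy: "x \<in> B" "y \<in> B" "fst x = fst y"
      show "x = y"
      proof (rule ccontr)
        assume "x \<noteq> y"
        then have "(x, y) \<in> blow (complete {..<k}) {..<n}" using decompD(4)[OF L B] xy by blast
        then show False using xy(3) by (auto simp: blow_def complete_def)
      qed
    qed
    have "fst ` B = {..<k}"
    proof (rule card_subset_eq)
      show "fst ` B \<subseteq> {..<k}" using sub by auto
      show "card (fst ` B) = card {..<k}" using card_image[OF inj] cB by simp
    qed simp
    then have "{..<4} \<subseteq> fst ` (B \<inter> S)"
    proof (intro subsetI)
      fix i :: nat assume i: "i \<in> {..<4}"
      then have "i \<in> fst ` B" using \<open>fst ` B = {..<k}\<close> k by auto
      then obtain u where u: "(i, u) \<in> B" by auto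
      then have "(i, u) \<in> S" using sub n(2)[of i] i by (auto simp: S_def)
      then show "i \<in> fst ` (B \<inter> S)" using u by force
    qed
    then have "card {..<4::nat} \<le> card (B \<inter> S)"
      using fB by (meson card_image_le card_mono finite_Int finite_imageI le_trans)
    moreover have "card (B \<inter> S) \<le> k" using card_mono[of B "B \<inter> S"] fB cB by simp
    ultimately show ?thesis by simp
  qed
  obtain L' where L': "decomp {4..k} (blow (complete {..<k}) {..<n} \<inter> S \<times> S) L'"
    using decomp_restrict[OF L, of S "{4..k}"] card by blast
  obtain L'' where "decomp {4} (blow (blow (complete {..<k}) {..<n} \<inter> S \<times> S) {..<g}) L''"
    using decomp_blow[OF L', of "{..<g}" "{4}"] g by auto
  moreover have "blow (blow (complete {..<k}) {..<n} \<inter> S \<times> S) {..<g}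
      = {(x, y). x \<in> X \<and> y \<in> X \<and> fst (fst x) \<noteq> fst (fst y)}"
    using n(1) by (fastforce simp: blow_def complete_def X S_def)
  ultimately show ?thesis by auto
qed

text \<open>The first \<open>m\<close> groups are filled around a common hole of \<open>w\<close>
  points. By the bounds on \<open>m\<close> at most one group is left over, and its points enlarge
  the hole.\<close>

lemma holey_truncated:
  assumes td: "gdd {k} n k" and n: "\<And>i. i < k \<Longrightarrow> a i \<le> n" "\<And>i. i < 4 \<Longrightarrow> a i = n" and k: "4 \<le> k"
    and g: "\<And>s. 4 \<le> s \<Longrightarrow> s \<le> k \<Longrightarrow> gdd {4} g s"
    and m: "m \<le> k" "k \<le> Suc m" and h: "\<And>i. i < m \<Longrightarrow> holey w (g * a i)"
  shows "holey (w + g * (\<Sum>i\<in>{m..<k}. a i)) (g * (\<Sum>i<m. a i))"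
proof -
  define X where "X = (SIGMA i:{..<k}. {..<a i}) \<times> {..<g}"
  \<comment> \<open>The hole points get first coordinate \<open>k\<close>, which belongs to no
    group.\<close>
  define W where "W = {((k, z), 0::nat) | z. z < w}"
  let ?c = "\<lambda>x :: (nat \<times> nat) \<times> nat. fst (fst x)"
  obtain L0 where L0: "decomp {4} {(x, y). x \<in> X \<and> y \<in> X \<and> ?c x \<noteq> ?c y} L0"
    using decomp_truncated[OF td n k g X_def] by auto
  have W: "W = (\<lambda>z. ((k, z), 0)) ` {..<w}" by (auto simp: W_def)
  have cW: "card W = w" "finite W" unfolding W by (simp_all add: card_image inj_on_def)
  have XW: "X \<inter> W = {}" by (auto simp: X_def W_def)
  have fX: "finite X" by (auto simp: X_def)
  have cX: "card {x \<in> X. ?c x \<in> J} = g * (\<Sum>i\<in>J. a i)" if "J \<subseteq> {..<k}" for J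
  proof -
    have "{x \<in> X. ?c x \<in> J} = (SIGMA i:J. {..<a i}) \<times> {..<g}" using that by (auto simp: X_def)
    moreover have "finite J" using that finite_subset by blast
    ultimately show ?thesis by (simp add: card_cartesian_product)
  qed
  have "\<exists>D L. fill {x \<in> X. ?c x = i} W D L \<and> opps D = {}" if "i < m" for i
  proof (rule holey_fill)
    have "card {x \<in> X. ?c x = i} = g * a i" using cX[of "{i}"] that m by simp
    then show "holey (card W) (card {x \<in> X. ?c x = i})" using h[OF that] cW by simp
  qed (use fX cW XW in auto)
  then have "\<forall>i. \<exists>D L. i < m \<longrightarrow> fill {x \<in> X. ?c x = i} W D L \<and> opps D = {}"
    by blast
  then obtain D L where "\<forall>i. i < m \<longrightarrow> fill {x \<in> X. ?c x = i} W (D i) (L i) \<and> opps (D i) = {}"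
    unfolding choice_iff by (elim exE) (rule that)
  then have DL: "fill {x \<in> X. ?c x = i} W (D i) (L i)" "opps (D i) = {}" if "i < m" for i
    using that by simp_all
  have Z: "{x \<in> X. ?c x \<notin> {..<m}} = {x \<in> X. ?c x \<in> {m..<k}}" by (auto simp: X_def)
  have F: "fill {x \<in> X. ?c x \<in> {..<m}} (W \<union> {x \<in> X. ?c x \<notin> {..<m}}) (\<Union>i\<in>{..<m}. D i) (L0 \<union> (\<Union>i\<in>{..<m}. L i))"
  proof (rule fill_groups[OF L0 _ _ XW])
    show "fill {x \<in> X. ?c x = i} W (D i) (L i)" if "i \<in> {..<m}" for i using DL(1) that by simp
    show "?c x = ?c y" if "x \<in> X" "y \<in> X" "?c x \<notin> {..<m}" "?c y \<notin> {..<m}" for x y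
      using that m by (auto simp: X_def)
  qed
  have "opps (\<Union>i\<in>{..<m}. D i) = (\<Union>i\<in>{..<m}. opps (D i))"
  proof (rule opps_UN)
    show "D i \<subseteq> complete {x \<in> X. ?c x = i}" if "i \<in> {..<m}" for i
      using fillD(2)[OF DL(1)] that by simp
  qed auto
  then have "opps (\<Union>i\<in>{..<m}. D i) = {}" using DL(2) by simp
  from holeyI[OF F _ _ this] have "holey (card (W \<union> {x \<in> X. ?c x \<notin> {..<m}})) (card {x \<in> X. ?c x \<in> {..<m}})"
    using fX cW by simp
  moreover have "card (W \<union> {x \<in> X. ?c x \<notin> {..<m}}) = w + g * (\<Sum>i\<in>{m..<k}. a i)"
  proof -
    have "{m..<k} \<subseteq> {..<k}" by auto
    note cX[OF this]
    moreover have "W \<inter> {x \<in> X. ?c x \<in> {m..<k}} = {}" using XW by blast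
    ultimately show ?thesis unfolding Z using cW fX by (simp add: card_Un_disjoint)
  qed
  moreover have "card {x \<in> X. ?c x \<in> {..<m}} = g * (\<Sum>i<m. a i)" using cX[of "{..<m}"] m by simp
  ultimately show ?thesis by simp
qed

section \<open>Designs generated by translations\<close>

text \<open>
  Points are the integers below \<open>n t + w\<close>: the translation by \<open>u\<close> acts on each of the \<open>t\<close> orbits
  \<open>{i n, \<dots>, i n + n - 1}\<close> as addition of \<open>u\<close> modulo \<open>n\<close>, and fixes the \<open>w\<close> points from \<open>n t\<close> onwards.
\<close>

lemma zdiv_less_iff:
  fixes a b c :: int
  assumes "0 < c"
  shows "a div c < b \<longleftrightarrow> a < c * b"
proof
  assume "a div c < b"
  then have "c * (a div c + 1) \<le> c * b" using assms by (intro mult_left_mono) auto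
  then have "c * (a div c) + c \<le> c * b" by (simp add: distrib_left)
  moreover have "a = c * (a div c) + a mod c" by simp
  ultimately show "a < c * b" using pos_mod_bound[OF assms, of a] by linarith
next
  assume *: "a < c * b"
  show "a div c < b"
  proof (rule ccontr)
    assume "\<not> a div c < b"
    then have "c * b \<le> c * (a div c)" using assms by (intro mult_left_mono) auto
    then show False using * mult_div_mod_eq[of c a] pos_mod_sign[OF assms, of a] by simp
  qed
qed

definition shift :: "int \<Rightarrow> int \<Rightarrow> int \<Rightarrow> int \<Rightarrow> int" where
  "shift n t u p = (if p < n * t then p div n * n + (p mod n + u) mod n else p)"

definition translates :: "int \<Rightarrow> int \<Rightarrow> int list list \<Rightarrow> int set set" where
  "translates n t Bs = {shift n t u ` set B | u B. B \<in> set Bs}"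

text \<open>The blocks through the base point \<open>i * n\<close>: each point of a base block in
  orbit \<open>i\<close> is translated to it. A base block fixed by a non-trivial translation yields
  the same block repeatedly; sorting and \<open>remdups\<close> identify the copies.\<close>

definition through :: "int \<Rightarrow> int \<Rightarrow> int list list \<Rightarrow> int \<Rightarrow> int list list" where
  "through n t Bs i = remdups (concat (map (\<lambda>B. map (\<lambda>z. sort (map (shift n t (- (z mod n))) B))
    (filter (\<lambda>z. z < n * t \<and> z div n = i) B)) Bs))"

text \<open>Multiplicities between different blocks are kept: comparing the sorted list with a
  duplicate-free one tests that each required pair is covered exactly once.\<close>

definition nbrs :: "int \<Rightarrow> int \<Rightarrow> int list list \<Rightarrow> int \<Rightarrow> int list" where
  "nbrs n t Bs i = concat (map (filter (\<lambda>y. y \<noteq> i * n)) (through n t Bs i))"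

context
  fixes n t :: int
  assumes n: "0 < n"
begin

lemma shift_eq: "p < n * t \<Longrightarrow> shift n t u p = p div n * n + (p mod n + u) mod n"
  by (simp add: shift_def)

lemma shift_div: "p < n * t \<Longrightarrow> shift n t u p div n = p div n"
  using n by (simp add: shift_eq)

lemma shift_mod: "p < n * t \<Longrightarrow> shift n t u p mod n = (p mod n + u) mod n"
  using n by (simp add: shift_eq)

lemma shift_less [simp]: "shift n t u p < n * t \<longleftrightarrow> p < n * t"
proof (cases "p < n * t")
  case True
  then have "shift n t u p div n < t" using shift_div[OF True] by (simp add: zdiv_less_iff[OF n])
  then have "shift n t u p < n * t" by (simp add: zdiv_less_iff[OF n])
  with True show ?thesis by simp
qed (simp add: shift_def)

lemma shift_nonneg: "0 \<le> p \<Longrightarrow> 0 \<le> shift n t u p"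
  using n by (simp add: shift_def pos_imp_zdiv_nonneg_iff)

lemma shift_bound: "p < n * t + w \<Longrightarrow> 0 \<le> w \<Longrightarrow> shift n t u p < n * t + w"
  using shift_less[of u p] by (cases "p < n * t") (auto simp: shift_def)

lemma shift_shift: "shift n t u (shift n t v p) = shift n t (u + v) p"
proof (cases "p < n * t")
  case True
  then have "shift n t u (shift n t v p) = p div n * n + ((p mod n + v) mod n + u) mod n"
    using shift_eq[of "shift n t v p" u] by (simp add: shift_div shift_mod)
  also have "((p mod n + v) mod n + u) mod n = (p mod n + (u + v)) mod n"
    by (simp add: mod_simps add.assoc add.commute[of u v])
  finally show ?thesis using True by (simp add: shift_eq)
qed (simp add: shift_def)

lemma shift_0: "shift n t 0 p = p"
  by (simp add: shift_def)

lemma shift_cong: "u mod n = v mod n \<Longrightarrow> shift n t u p = shift n t v p"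
  unfolding shift_def by (metis mod_add_right_eq)

lemma shift_inverse [simp]: "shift n t u (shift n t (- u) p) = p" "shift n t (- u) (shift n t u p) = p"
  by (simp_all add: shift_shift shift_0)

lemma inj_shift: "inj (shift n t u)"
  by (rule injI) (metis shift_inverse(2))

lemma shift_base: "p < n * t \<Longrightarrow> shift n t (- (p mod n)) p = p div n * n"
  by (simp add: shift_eq)

lemma shift_base': "p < n * t \<Longrightarrow> shift n t (p mod n) (p div n * n) = p"
  using shift_inverse(1)[of "p mod n" p] by (simp add: shift_base)

lemma translates_shift:
  assumes "B \<in> translates n t Bs"
  shows "shift n t u ` B \<in> translates n t Bs"
proof -
  obtain v C where "C \<in> set Bs" "B = shift n t v ` set C" using assms by (auto simp: translates_def)
  then have "shift n t u ` B = shift n t (u + v) ` set C" by (simp add: image_image shift_shift)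
  then show ?thesis using \<open>C \<in> set Bs\<close> unfolding translates_def by blast
qed

lemma through_translates:
  assumes "l \<in> set (through n t Bs i)"
  shows "set l \<in> translates n t Bs" "i * n \<in> set l"
proof -
  obtain B z where B: "B \<in> set Bs" "z \<in> set B" "z < n * t" "z div n = i"
    "l = sort (map (shift n t (- (z mod n))) B)"
    using assms by (auto simp: through_def)
  then show "set l \<in> translates n t Bs" by (auto simp: translates_def)
  have "shift n t (- (z mod n)) z \<in> set l" using B by simp
  then show "i * n \<in> set l" using shift_base[OF B(3)] B(4) by simp
qed

lemma translates_through:
  assumes "B \<in> translates n t Bs" "x \<in> B" "x < n * t"
  obtains l where "l \<in> set (through n t Bs (x div n))" "set l = shift n t (- (x mod n)) ` B"
proof -
  obtain v C where C: "C \<in> set Bs" "B = shift n t v ` set C" using assms(1) by (auto simp: translates_def)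
  obtain z where z: "z \<in> set C" "x = shift n t v z" using assms(2) C by auto
  have znt: "z < n * t" using assms(3) z by simp
  have x: "x div n = z div n" "x mod n = (z mod n + v) mod n"
    using z znt by (simp_all add: shift_div shift_mod)
  let ?l = "sort (map (shift n t (- (z mod n))) C)"
  have "?l \<in> set (through n t Bs (x div n))"
    unfolding through_def using C z znt x by auto
  moreover have "(- (x mod n) + v) mod n = (- (z mod n)) mod n"
    unfolding x(2) by (simp add: mod_simps)
  then have "shift n t (- (x mod n)) (shift n t v p) = shift n t (- (z mod n)) p" for p
    unfolding shift_shift by (rule shift_cong)
  then have "set ?l = shift n t (- (x mod n)) ` B"
    unfolding C(2) by (simp add: image_image)
  ultimately show thesis by (rule that)
qed

text \<open>Graph and blocks are invariant under translation, so one base point in each orbit is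
  inspected. In \<open>ch\<close>, equality of elements gives coverage, and absence of repetitions
  gives uniqueness. Every edge has an end that is not a fixed point, and this end is moved to the
  base point.\<close>

lemma decomp_translates:
  assumes t: "0 \<le> t" and w: "0 \<le> w"
    and Bs: "\<And>B. B \<in> set Bs \<Longrightarrow> distinct B \<and> length B = 4 \<and> length (filter (\<lambda>z. n * t \<le> z) B) \<le> 1"
    and E: "\<And>x y. E x y \<Longrightarrow> E y x" "\<And>x y. E x y \<Longrightarrow> x \<noteq> y \<and> 0 \<le> x \<and> x < n * t + w \<and> (x < n * t \<or> y < n * t)"
    and inv: "\<And>u x y. E x y \<Longrightarrow> E (shift n t u x) (shift n t u y)"
    and ch: "\<And>i. 0 \<le> i \<Longrightarrow> i < t \<Longrightarrow> sort (nbrs n t Bs i) = filter (E (i * n)) [0..n * t + w - 1]"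
    and pos: "\<And>B. B \<in> set Bs \<Longrightarrow> set B \<subseteq> {0..}"
  shows "decomp {4} {(x, y). E x y} (translates n t Bs)"
proof -
  let ?L = "translates n t Bs"
  have nb: "E (i * n) y \<longleftrightarrow> y \<in> set (nbrs n t Bs i)" if i: "0 \<le> i" "i < t" for i y
  proof -
    have "set (nbrs n t Bs i) = set (sort (nbrs n t Bs i))" by simp
    also have "\<dots> = {y. E (i * n) y \<and> 0 \<le> y \<and> y < n * t + w}" unfolding ch[OF i] by auto
    finally show ?thesis using E by blast
  qed
  have dist: "distinct (nbrs n t Bs i)" if i: "0 \<le> i" "i < t" for i
  proof -
    have "distinct (sort (nbrs n t Bs i))" unfolding ch[OF i] by simp
    then show ?thesis by simp
  qed
  have idx: "0 \<le> x div n \<and> x div n < t" if "0 \<le> x" "x < n * t" for x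
    using n that by (simp add: pos_imp_zdiv_nonneg_iff zdiv_less_iff)
  have Epos: "0 \<le> x" "0 \<le> y" if "E x y" for x y using E that by blast+
  have Lpos: "0 \<le> x" if "B \<in> ?L" "x \<in> B" for B x
    using that pos shift_nonneg by (fastforce simp: translates_def)
  have Lcard: "card B = 4" if B: "B \<in> ?L" for B
  proof -
    obtain u C where C: "C \<in> set Bs" "B = shift n t u ` set C" using B by (auto simp: translates_def)
    have "card B = card (set C)" unfolding C(2) by (rule card_image[OF inj_on_subset[OF inj_shift]]) simp
    then show ?thesis using Bs[OF C(1)] by (simp add: distinct_card)
  qed
  \<comment> \<open>Fixed points stay fixed under translation and a base block contains at most one
    of them, so two distinct points of a block are never both fixed.\<close>
  have one: "x < n * t \<or> y < n * t" if B: "B \<in> ?L" and xy: "x \<in> B" "y \<in> B" "x \<noteq> y" for B x y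
  proof (rule ccontr)
    assume neg: "\<not> ?thesis"
    obtain u C where C: "C \<in> set Bs" "B = shift n t u ` set C" using B by (auto simp: translates_def)
    obtain a b where ab: "a \<in> set C" "b \<in> set C" "x = shift n t u a" "y = shift n t u b" using xy C by auto
    have "{a, b} \<subseteq> set (filter (\<lambda>z. n * t \<le> z) C)" using ab neg by auto
    then have "card {a, b} \<le> card (set (filter (\<lambda>z. n * t \<le> z) C))" by (rule card_mono[rotated]) simp
    also have "\<dots> \<le> 1" using Bs[OF C(1)] card_length le_trans by blast
    finally show False using ab xy(3) by (cases "a = b") auto
  qed
  have edge: "E x y" if B: "B \<in> ?L" and xy: "x \<in> B" "y \<in> B" "x \<noteq> y" "x < n * t" for B x y
  proof -
    obtain l where l: "l \<in> set (through n t Bs (x div n))" "set l = shift n t (- (x mod n)) ` B"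
      using translates_through[OF B xy(1,4)] .
    let ?y = "shift n t (- (x mod n)) y"
    have "?y \<noteq> x div n * n"
      using xy(3) injD[OF inj_shift, of "- (x mod n)" x y] shift_base[OF xy(4)] by auto
    moreover have "?y \<in> set l" using l xy by simp
    ultimately have "?y \<in> set (nbrs n t Bs (x div n))" using l(1) by (auto simp: nbrs_def)
    then have "E (x div n * n) ?y" using nb idx[OF Lpos[OF B xy(1)] xy(4)] by blast
    then have "E (shift n t (x mod n) (x div n * n)) (shift n t (x mod n) ?y)" by (rule inv)
    then show ?thesis using shift_base'[OF xy(4)] by simp
  qed
  have cover: "\<exists>B\<in>?L. x \<in> B \<and> y \<in> B" if e: "E x y" and x: "x < n * t" for x y
  proof -
    let ?y = "shift n t (- (x mod n)) y"
    have "E (x div n * n) ?y" using inv[OF e, of "- (x mod n)"] shift_base[OF x] by simp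
    then have "?y \<in> set (nbrs n t Bs (x div n))" using nb idx[OF Epos(1)[OF e] x] by blast
    then obtain l where l: "l \<in> set (through n t Bs (x div n))" "?y \<in> set l" by (auto simp: nbrs_def)
    have "shift n t (x mod n) ` set l \<in> ?L"
      by (rule translates_shift[OF through_translates(1)[OF l(1)]])
    moreover have "x \<in> shift n t (x mod n) ` set l"
      using through_translates(2)[OF l(1)] shift_base'[OF x] by (metis image_eqI)
    moreover have "y \<in> shift n t (x mod n) ` set l"
      using l(2) shift_inverse(1)[of "x mod n" y] by (metis image_eqI)
    ultimately show ?thesis by blast
  qed
  have uniq: "B = C" if e: "E x y" and x: "x < n * t" and BC: "B \<in> ?L" "C \<in> ?L"
    and m: "x \<in> B" "y \<in> B" "x \<in> C" "y \<in> C" for x y B C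
  proof -
    let ?s = "shift n t (- (x mod n))"
    have ne: "x \<noteq> y" using E(2)[OF e] by blast
    obtain l where l: "l \<in> set (through n t Bs (x div n))" "set l = ?s ` B"
      using translates_through[OF BC(1) m(1) x] .
    obtain l' where l': "l' \<in> set (through n t Bs (x div n))" "set l' = ?s ` C"
      using translates_through[OF BC(2) m(3) x] .
    have "?s y \<noteq> x div n * n"
      using ne injD[OF inj_shift, of "- (x mod n)" x y] shift_base[OF x] by auto
    then have y: "?s y \<in> set (filter (\<lambda>y. y \<noteq> x div n * n) l)" "?s y \<in> set (filter (\<lambda>y. y \<noteq> x div n * n) l')"
      using l(2) l'(2) m by auto
    \<comment> \<open>If two different lists contained the common point \<open>?s y\<close>, it
      would occur twice in the concatenation.\<close>
    have d: "distinct (concat (map (filter (\<lambda>y. y \<noteq> x div n * n)) ls)) \<Longrightarrow> l \<in> set ls \<Longrightarrow> l' \<in> set ls \<Longrightarrow> l = l'" for ls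
      using y by (induction ls) auto
    have "l = l'"
      using d[OF _ l(1) l'(1)] dist[of "x div n"] idx[OF Epos(1)[OF e] x] unfolding nbrs_def by blast
    then have "?s ` B = ?s ` C" using l l' by simp
    then show ?thesis using inj_image_eq_iff[OF inj_shift] by blast
  qed
  show ?thesis
  proof (rule decompI)
    show "card B \<in> {4}" "2 \<le> card B" if "B \<in> ?L" for B using Lcard[OF that] by simp_all
    show "(x, y) \<in> {(x, y). E x y}" if B: "B \<in> ?L" "x \<in> B" "y \<in> B" "x \<noteq> y" for B x y
      using edge[OF B] edge[OF B(1,3,2) B(4)[symmetric]] E(1) one[OF B] by blast
    fix x y assume "(x, y) \<in> {(x, y). E x y}"
    then have e: "E x y" "E y x" using E(1) by simp_all
    show "x \<noteq> y" using E(2)[OF e(1)] by blast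
    have f: "x < n * t \<or> y < n * t" using E(2)[OF e(1)] by blast
    show "\<exists>B\<in>?L. x \<in> B \<and> y \<in> B" using cover[OF e(1)] cover[OF e(2)] f by blast
    show "B = C" if "B \<in> ?L" "C \<in> ?L" "x \<in> B" "y \<in> B" "x \<in> C" "y \<in> C" for B C
      using uniq[OF e(1) _ that] uniq[OF e(2) _ that(1,2,4,3,6,5)] f by blast
  qed
qed

end

definition base_check :: "int \<Rightarrow> int \<Rightarrow> int list list \<Rightarrow> bool" where
  "base_check n t Bs \<longleftrightarrow> list_all (\<lambda>B. distinct B \<and> length B = 4 \<and> list_all (\<lambda>z. 0 \<le> z) B \<and>
    length (filter (\<lambda>z. n * t \<le> z) B) \<le> 1) Bs"

text \<open>The groups are the residue classes modulo \<open>s\<close>, which the translations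
  permute when \<open>s\<close> divides \<open>n\<close>.\<close>

definition gdd_check :: "int \<Rightarrow> int \<Rightarrow> int \<Rightarrow> int list list \<Rightarrow> bool" where
  "gdd_check n t s Bs \<longleftrightarrow> base_check n t Bs \<and>
    list_all (\<lambda>i. sort (nbrs n t Bs i) = filter (\<lambda>y. i * n mod s \<noteq> y mod s) [0..n * t - 1]) [0..t - 1]"

lemma base_checkD:
  assumes "base_check n t Bs" "B \<in> set Bs"
  shows "distinct B \<and> length B = 4 \<and> length (filter (\<lambda>z. n * t \<le> z) B) \<le> 1" "set B \<subseteq> {0..}"
  using assms unfolding base_check_def list_all_iff by auto

lemma gdd_cyclic:
  assumes c: "gdd_check n t s Bs" and n: "0 < n" "0 \<le> t" and s: "0 < s" "s dvd n" and g: "0 \<le> g" "n * t = g * s"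
  shows "gdd {4} (nat g) (nat s)"
proof -
  define E where "E x y \<longleftrightarrow> 0 \<le> x \<and> x < n * t \<and> 0 \<le> y \<and> y < n * t \<and> x mod s \<noteq> y mod s" for x y :: int
  have bc: "base_check n t Bs" using c by (simp add: gdd_check_def)
  have shift_mod_s: "shift n t u x mod s = (x + u) mod s" if "x < n * t" for u x
  proof -
    have "shift n t u x mod s = (x div n * n + (x mod n + u) mod n) mod s" using that by (simp add: shift_def)
    also have "\<dots> = (x div n * n + (x mod n + u)) mod s"
      using s(2) by (metis mod_add_right_eq mod_mod_cancel)
    finally show ?thesis by (simp add: add.assoc[symmetric])
  qed
  have "decomp {4} {(x, y). E x y} (translates n t Bs)"
  proof (rule decomp_translates[OF n(1) n(2) order_refl])
    show "E (shift n t u x) (shift n t u y)" if "E x y" for u x y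
    proof -
      have "(x + u) mod s \<noteq> (y + u) mod s"
        using that by (metis E_def add_diff_cancel_right' mod_diff_left_eq)
      then show ?thesis
        using that shift_nonneg[OF n(1)] shift_less[OF n(1)] by (simp add: E_def shift_mod_s)
    qed
    show "sort (nbrs n t Bs i) = filter (E (i * n)) [0..n * t + 0 - 1]" if i: "0 \<le> i" "i < t" for i
    proof -
      have "sort (nbrs n t Bs i) = filter (\<lambda>y. i * n mod s \<noteq> y mod s) [0..n * t - 1]"
        using c i by (auto simp: gdd_check_def list_all_iff)
      also have "\<dots> = filter (E (i * n)) [0..n * t - 1]"
        using n i by (intro filter_cong) (auto simp: E_def mult.commute[of i n])
      finally show ?thesis by simp
    qed
  qed (use base_checkD[OF bc] in \<open>auto simp: E_def\<close>)
  moreover have sub: "{(x, y). E x y} \<subseteq> {0..<n * t} \<times> {0..<n * t}" by (auto simp: E_def)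
  define f where "f x = (nat (x mod s), nat (x div s))" for x :: int
  have inj: "inj_on f {0..<n * t}"
  proof (rule inj_onI)
    fix x y assume xy: "x \<in> {0..<n * t}" "y \<in> {0..<n * t}" "f x = f y"
    have "x mod s = y mod s" "x div s = y div s"
      using xy s(1) by (auto simp: f_def pos_imp_zdiv_nonneg_iff eq_nat_nat_iff)
    then show "x = y" by (metis div_mult_mod_eq)
  qed
  have fin: "f x \<in> {..<nat s} \<times> {..<nat g}" if "0 \<le> x" "x < n * t" for x
  proof -
    have "x div s < g" using that s(1) g by (simp add: zdiv_less_iff mult.commute)
    moreover have "0 \<le> x div s" using that s(1) by (simp add: pos_imp_zdiv_nonneg_iff)
    ultimately show ?thesis using s(1) by (auto simp: f_def nat_less_iff)
  qed
  have "map_prod f f ` {(x, y). E x y} = blow (complete {..<nat s}) {..<nat g}" (is "?l = ?r")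
  proof
    show "?l \<subseteq> ?r"
    proof
      fix e assume "e \<in> ?l"
      then obtain x y where e: "e = (f x, f y)" "E x y" by auto
      then have "f x \<in> {..<nat s} \<times> {..<nat g}" "f y \<in> {..<nat s} \<times> {..<nat g}" using fin by (auto simp: E_def)
      moreover have "fst (f x) \<noteq> fst (f y)" using e(2) s(1) by (auto simp: f_def E_def eq_nat_nat_iff)
      ultimately show "e \<in> ?r" unfolding e(1) by (cases "f x"; cases "f y") (auto simp: blow_def complete_def)
    qed
    show "?r \<subseteq> ?l"
    proof
      fix e assume "e \<in> ?r"
      then obtain i j u v where e: "e = ((i, u), (j, v))" "i < nat s" "j < nat s" "i \<noteq> j" "u < nat g" "v < nat g"
        by (auto simp: blow_def complete_def)
      have *: "f (int u * s + int i) = (i, u) \<and> 0 \<le> int u * s + int i \<and> int u * s + int i < n * t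
          \<and> (int u * s + int i) mod s = int i"
        if "i < nat s" "u < nat g" for i u
      proof -
        have i: "int i < s" and u: "int u + 1 \<le> g" using that s(1) g(1) by (simp_all add: zless_nat_eq_int_zless)
        have "int u * s + int i < (int u + 1) * s" using i by (simp add: distrib_right)
        also have "\<dots> \<le> g * s" using u s(1) by (intro mult_right_mono) auto
        finally show ?thesis using i s(1) g(2) by (simp add: f_def)
      qed
      show "e \<in> ?l"
        by (rule rev_image_eqI[of "(int u * s + int i, int v * s + int j)"])
          (use e *[of i u] *[of j v] in \<open>auto simp: E_def\<close>)
    qed
  qed
  ultimately show ?thesis using decomp_image[OF _ sub inj] unfolding gdd_def by metis
qed

text \<open>The list \<open>Ns\<close> holds the neighbourhoods of the points \<open>i n\<close> in the deficiency graph; they serve as base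
  blocks as well. The last conjunct, that two neighbours of \<open>i n\<close> have different neighbourhoods, rules out
  opposite pairs.\<close>

definition fill_check :: "int \<Rightarrow> int \<Rightarrow> int \<Rightarrow> int list list \<Rightarrow> int list list \<Rightarrow> bool" where
  "fill_check n t w Ns Cs \<longleftrightarrow> base_check n t (Ns @ Cs) \<and> int (length Ns) = t \<and>
    list_all (\<lambda>i. sort (nbrs n t (Ns @ Cs) i) = filter (\<lambda>y. y \<noteq> i * n \<and> y \<notin> set (Ns ! nat i)) [0..n * t + w - 1] \<and>
      i * n \<notin> set (Ns ! nat i) \<and>
      list_all (\<lambda>y. y < n * t \<and> shift n t (- (y mod n)) (i * n) \<in> set (Ns ! nat (y div n))) (Ns ! nat i) \<and>
      (let a = Ns ! nat i ! 0; b = Ns ! nat i ! 1 in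
        list_ex (\<lambda>z. shift n t (a mod n) z \<notin> set (map (shift n t (b mod n)) (Ns ! nat (b div n)))) (Ns ! nat (a div n))))
      [0..t - 1]"

text \<open>\<open>D\<close> is the translation-invariant graph with the listed neighbourhoods at
  the base points. Its neighbourhoods are translates of base blocks, hence blocks, and by invariance
  its properties are checked at the base points only.\<close>

lemma holey_cyclic:
  assumes c: "fill_check n t w Ns Cs" and n: "0 < n" "0 \<le> t" "0 \<le> w"
  shows "holey (nat w) (nat (n * t))"
proof -
  let ?N = "\<lambda>i. set (Ns ! nat i)"
  define D where "D = {(x, y). 0 \<le> x \<and> x < n * t \<and> 0 \<le> y \<and> y < n * t \<and> shift n t (- (x mod n)) y \<in> ?N (x div n)}"
  define E where "E x y \<longleftrightarrow> 0 \<le> x \<and> x < n * t + w \<and> 0 \<le> y \<and> y < n * t + w \<and> x \<noteq> y \<and> (x < n * t \<or> y < n * t) \<and> (x, y) \<notin> D" for x y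
  note sh = shift_nonneg[OF n(1)] shift_less[OF n(1)] shift_bound[OF n(1) _ n(3)] shift_inverse[OF n(1)]
  have bc: "base_check n t (Ns @ Cs)" using c by (simp add: fill_check_def)
  have len: "int (length Ns) = t" using c by (simp add: fill_check_def)
  have ch: "sort (nbrs n t (Ns @ Cs) i) = filter (\<lambda>y. y \<noteq> i * n \<and> y \<notin> ?N i) [0..n * t + w - 1]"
      "i * n \<notin> ?N i" "\<forall>y\<in>?N i. y < n * t \<and> shift n t (- (y mod n)) (i * n) \<in> ?N (y div n)"
      "\<exists>z\<in>?N (Ns ! nat i ! 0 div n). shift n t (Ns ! nat i ! 0 mod n) z
        \<notin> shift n t (Ns ! nat i ! 1 mod n) ` ?N (Ns ! nat i ! 1 div n)"
    if "0 \<le> i" "i < t" for i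
    using c that by (auto simp: fill_check_def list_all_iff list_ex_iff Let_def)
  have Nin: "Ns ! nat i \<in> set Ns" if "0 \<le> i" "i < t" for i
    using len that by (intro nth_mem) auto
  have Npos: "0 \<le> y" if "0 \<le> i" "i < t" "y \<in> ?N i" for i y
    using base_checkD(2)[OF bc, of "Ns ! nat i"] Nin[OF that(1,2)] that(3) by auto
  have idx: "0 \<le> x div n \<and> x div n < t" if "0 \<le> x" "x < n * t" for x
    using n that by (simp add: pos_imp_zdiv_nonneg_iff zdiv_less_iff)
  have Dinv: "(shift n t u x, shift n t u y) \<in> D" if D: "(x, y) \<in> D" for u x y
  proof -
    have x: "x < n * t" using D by (simp add: D_def)
    have "shift n t (- (shift n t u x mod n)) (shift n t u y) = shift n t (- (x mod n)) y"
      unfolding shift_shift[OF n(1)]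
      by (rule shift_cong[OF n(1)]) (simp add: shift_mod[OF n(1) x] mod_simps)
    then show ?thesis using D sh by (simp add: D_def shift_div[OF n(1) x])
  qed
  have Dinv': "(shift n t u x, shift n t u y) \<in> D \<longleftrightarrow> (x, y) \<in> D" for u x y
    using Dinv[of x y u] Dinv[of "shift n t u x" "shift n t u y" "- u"] sh by auto
  have Dbase: "(i * n, y) \<in> D \<longleftrightarrow> y \<in> ?N i" if i: "0 \<le> i" "i < t" for i y
  proof -
    have "i * n < n * t" using i n by (simp add: mult.commute)
    moreover have "0 \<le> i * n" using i n by simp
    ultimately show ?thesis
      using ch(3)[OF i] Npos[OF i] n by (auto simp: D_def shift_0[OF n(1)])
  qed
  have Dsym: "(y, x) \<in> D" if D: "(x, y) \<in> D" for x y
  proof -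
    have x: "0 \<le> x" "x < n * t" using D by (auto simp: D_def)
    let ?i = "x div n" and ?y = "shift n t (- (x mod n)) y"
    have yN: "?y \<in> ?N ?i" using D by (simp add: D_def)
    have "(?y, ?i * n) \<in> D"
      unfolding D_def using ch(3)[OF idx[OF x, THEN conjunct1] idx[OF x, THEN conjunct2]] yN Npos[of ?i ?y]
        idx[OF x] n mult_strict_right_mono[of ?i t n] by (auto simp: mult.commute)
    then have "(shift n t (- (x mod n)) y, shift n t (- (x mod n)) x) \<in> D"
      using shift_base[OF n(1) x(2)] by simp
    then show ?thesis using Dinv' by blast
  qed
  have Dirr: "(x, x) \<notin> D" for x
  proof
    assume D: "(x, x) \<in> D"
    then have x: "0 \<le> x" "x < n * t" by (auto simp: D_def)
    have "x div n * n \<in> ?N (x div n)" using D shift_base[OF n(1) x(2)] by (simp add: D_def)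
    then show False using ch(2) idx[OF x] by blast
  qed
  have Dcomp: "D \<subseteq> complete {0..<n * t}"
    using Dirr by (auto simp: D_def complete_def)
  have Dimg: "D `` {x} = shift n t (x mod n) ` ?N (x div n)" if x: "0 \<le> x" "x < n * t" for x
  proof -
    have "(x, y) \<in> D \<longleftrightarrow> y \<in> shift n t (x mod n) ` ?N (x div n)" for y
    proof
      assume "(x, y) \<in> D"
      then have "shift n t (- (x mod n)) y \<in> ?N (x div n)" by (simp add: D_def)
      then show "y \<in> shift n t (x mod n) ` ?N (x div n)" using sh(4) by (metis image_eqI)
    next
      assume "y \<in> shift n t (x mod n) ` ?N (x div n)"
      then obtain z where z: "z \<in> ?N (x div n)" "y = shift n t (x mod n) z" by blast
      then have "(x div n * n, z) \<in> D" using Dbase idx[OF x] by blast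
      then show "(x, y) \<in> D" using Dinv[of "x div n * n" z "x mod n"] z shift_base'[OF n(1) x(2)] by simp
    qed
    then show ?thesis by auto
  qed
  have "decomp {4} {(x, y). E x y} (translates n t (Ns @ Cs))"
  proof (rule decomp_translates[OF n])
    show "E y x" if "E x y" for x y using that Dsym by (auto simp: E_def)
    show "E (shift n t u x) (shift n t u y)" if "E x y" for u x y
      using that sh Dinv' injD[OF inj_shift[OF n(1)], of t u x y] by (auto simp: E_def)
    show "sort (nbrs n t (Ns @ Cs) i) = filter (E (i * n)) [0..n * t + w - 1]" if i: "0 \<le> i" "i < t" for i
    proof -
      have b: "i * n < n * t" "0 \<le> i * n" using i n by (simp_all add: mult.commute)
      show ?thesis unfolding ch(1)[OF i]
        by (intro filter_cong refl) (use b n(3) Dbase[OF i] in \<open>auto simp: E_def\<close>)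
    qed
    show "x \<noteq> y \<and> 0 \<le> x \<and> x < n * t + w \<and> (x < n * t \<or> y < n * t)" if "E x y" for x y
      using that by (simp add: E_def)
  qed (use base_checkD[OF bc] in auto)
  moreover have "{(x, y). E x y} = complete ({0..<n * t} \<union> {n * t..<n * t + w}) - complete {n * t..<n * t + w} - D"
    using n by (auto simp: E_def complete_def)
  moreover have "D `` {x} \<in> translates n t (Ns @ Cs)" if "x \<in> {0..<n * t}" for x
  proof -
    have x: "0 \<le> x" "x < n * t" using that by auto
    have "Ns ! nat (x div n) \<in> set (Ns @ Cs)" using Nin idx[OF x] by simp
    then show ?thesis unfolding Dimg[OF x] translates_def by blast
  qed
  moreover have "sym D" using Dsym by (auto intro: symI)
  ultimately have F: "fill {0..<n * t} {n * t..<n * t + w} D (translates n t (Ns @ Cs))"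
    unfolding fill_def using Dcomp by auto
  have "opps D = {}"
  proof (rule ccontr)
    assume "opps D \<noteq> {}"
    then obtain p where p: "p \<in> opps D" by blast
    obtain l m where lm: "p = {l, m}" "l \<noteq> {}" "m \<noteq> {}" "\<forall>x\<in>l. D `` {x} = m" "\<forall>x\<in>m. D `` {x} = l"
      "l \<subseteq> {0..<n * t}" "m \<subseteq> {0..<n * t}"
      by (rule oppsE[OF p Dcomp], rule that)
    obtain x where xl: "x \<in> l" using lm(2) by blast
    then have x: "0 \<le> x" "x < n * t" using lm(6) by auto
    define i where "i = x div n"
    have i: "0 \<le> i" "i < t" using idx[OF x] by (simp_all add: i_def)
    let ?a = "Ns ! nat i ! 0" and ?b = "Ns ! nat i ! 1"
    have "length (Ns ! nat i) = 4" using base_checkD(1)[OF bc, of "Ns ! nat i"] Nin[OF i] by simp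
    then have ab: "?a \<in> ?N i" "?b \<in> ?N i" by simp_all
    \<comment> \<open>In an opposite pair all neighbours of \<open>x\<close> have the same
      neighbourhood \<open>l\<close>. Translating \<open>x\<close> to its base point, all listed
      \<open>c\<close> have the same neighbourhood, which contradicts the check for the first
      two.\<close>
    have eq: "D `` {c} = shift n t (- (x mod n)) ` l" if c: "c \<in> ?N i" for c
    proof -
      have "shift n t (x mod n) c \<in> D `` {x}" unfolding Dimg[OF x] using c by (simp add: i_def)
      then have "shift n t (x mod n) c \<in> m" using bspec[OF lm(4) xl] by simp
      then have "l = D `` {shift n t (x mod n) c}" using bspec[OF lm(5)] by simp
      moreover have "(c, y) \<in> D \<longleftrightarrow> y \<in> shift n t (- (x mod n)) ` D `` {shift n t (x mod n) c}" for y
      proof -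
        have "(c, y) \<in> D \<longleftrightarrow> shift n t (x mod n) y \<in> D `` {shift n t (x mod n) c}"
          using Dinv'[of "x mod n" c y] by simp
        also have "\<dots> \<longleftrightarrow> y \<in> shift n t (- (x mod n)) ` D `` {shift n t (x mod n) c}"
          using sh(4,5) by (metis (no_types, lifting) image_iff)
        finally show ?thesis .
      qed
      ultimately show ?thesis by auto
    qed
    have "D `` {?a} = D `` {?b}" using eq[OF ab(1)] eq[OF ab(2)] by simp
    then have "shift n t (?a mod n) ` ?N (?a div n) = shift n t (?b mod n) ` ?N (?b div n)"
      using Dimg Npos[OF i] ch(3)[OF i] ab by simp
    then show False using ch(4)[OF i] by blast
  qed
  then have "holey (card {n * t..<n * t + w}) (card {0..<n * t})"
    by (intro holeyI[OF F]) simp_all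
  then show ?thesis by simp
qed

section \<open>Explicit designs\<close>

text \<open>All base blocks below were found by a randomised exact cover search.\<close>

lemma gdd_12_4: "gdd {4} 12 4"
proof -
  have "gdd_check 24 2 4 [
   [0,2,15,45], [0,3,10,37], [0,1,19,26], [0,29,35,46], [0,33,38,47], [0,39,41,42]]"
    by code_simp
  from gdd_cyclic[OF this, of 12] show ?thesis by simp
qed

lemma gdd_12_5: "gdd {4} 12 5"
proof -
  have "gdd_check 30 2 5 [
   [0,2,11,53], [0,6,52,54], [0,4,16,33], [0,3,31,37], [0,1,8,44], [0,13,32,39], [0,38,41,57],
   [30,31,39,43]]"
    by code_simp
  from gdd_cyclic[OF this, of 12] show ?thesis by simp
qed

lemma gdd_12_6: "gdd {4} 12 6"
proof -
  have "gdd_check 72 1 6 [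
   [0,8,17,52], [0,7,34,56], [0,2,5,31], [0,1,14,33], [0,4,51,61]]"
    by code_simp
  from gdd_cyclic[OF this, of 12] show ?thesis by simp
qed

lemma gdd_12_7: "gdd {4} 12 7"
proof -
  have "gdd_check 84 1 7 [
   [0,2,67,80], [0,12,36,58], [0,3,37,57], [0,5,44,73], [0,1,9,32], [0,10,51,69]]"
    by code_simp
  from gdd_cyclic[OF this, of 12] show ?thesis by simp
qed

lemma gdd_12_8: "gdd {4} 12 8"
proof -
  have "gdd_check 96 1 8 [
   [0,2,33,68], [0,5,17,44], [0,9,29,55], [0,1,43,90], [0,4,75,86], [0,13,51,73], [0,3,18,37]]"
    by code_simp
  from gdd_cyclic[OF this, of 12] show ?thesis by simp
qed

text \<open>The projective plane of order 3, developed from the perfect difference set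
  \<open>{0, 1, 3, 9}\<close> modulo 13.\<close>

lemma gdd_1_13: "gdd {4} 1 13"
proof -
  have "gdd_check 13 1 13 [[0,1,3,9]]"
    by code_simp
  from gdd_cyclic[OF this, of 1] show ?thesis by simp
qed

text \<open>The sizes \<open>60 = 12 * 5\<close> and \<open>84 = 12 * 7\<close> supply the starting
  values 5 and 7 of the recursion, first for hole size 5 and then for hole size 8.\<close>

lemma holey_5_60: "holey 5 60"
proof -
  have "fill_check 10 6 5 [
   [22,30,41,59], [33,37,42,53], [8,47,54,56], [0,13,17,46], [9,18,23,34], [1,17,24,26]] [
   [0,5,33,38], [20,25,41,46], [10,15,52,57], [0,4,18,36], [0,1,8,55], [0,26,40,48],
   [40,41,44,54], [0,12,20,43], [0,27,42,62], [0,44,50,64], [0,15,45,61], [0,28,31,53],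
   [0,29,39,60], [10,44,56,60], [10,26,46,63], [0,10,34,47], [10,35,45,50], [0,11,21,52],
   [0,37,51,63], [10,30,31,48], [20,34,36,48], [10,11,13,24], [10,22,39,64], [10,54,55,58],
   [10,32,59,62], [20,32,39,50], [20,35,58,61], [20,21,24,53]]"
    by code_simp
  from holey_cyclic[OF this] show ?thesis by simp
qed

lemma holey_5_84: "holey 5 84"
proof -
  have "fill_check 14 6 5 [
   [1,13,57,83], [44,62,70,72], [33,37,46,78], [26,38,59,65], [13,22,47,53], [1,14,26,34]] [
   [14,21,58,65], [0,7,71,78], [28,35,45,52], [42,77,80,81], [14,41,73,79], [0,35,72,77],
   [28,68,82,85], [0,19,42,85], [0,14,24,74], [14,17,38,50], [14,59,69,80], [0,3,15,20],
   [14,15,30,77], [14,20,46,56], [0,18,46,73], [14,32,52,75], [14,37,71,86], [0,22,62,75],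
   [14,31,63,87], [0,16,41,88], [14,28,43,84], [0,21,55,67], [14,33,49,82], [14,55,57,66],
   [28,58,61,81], [0,61,80,84], [42,69,73,88], [0,32,60,76], [0,64,66,81], [0,43,79,87],
   [42,43,52,72], [42,44,63,64], [0,51,65,86], [0,29,30,68], [0,34,40,63], [0,4,28,59],
   [0,5,49,52], [0,36,39,50], [0,6,37,45], [28,30,49,64]]"
    by code_simp
  from holey_cyclic[OF this] show ?thesis by simp
qed

lemma holey_8_60: "holey 8 60"
proof -
  have "fill_check 20 3 8 [
   [20,38,42,59], [0,2,43,47], [1,18,33,37]] [
   [0,10,24,34], [40,45,50,55], [20,21,27,57], [0,6,28,37], [20,23,28,54], [0,33,51,63],
   [0,30,50,67], [0,1,8,56], [0,4,15,53], [40,41,52,54], [0,23,52,64], [0,26,54,66],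
   [0,21,46,62], [0,27,40,61], [0,25,57,65], [0,29,44,60]]"
    by code_simp
  from holey_cyclic[OF this] show ?thesis by simp
qed

lemma holey_8_84: "holey 8 84"
proof -
  have "fill_check 28 3 8 [
   [32,54,63,65], [2,24,33,51], [19,21,60,80]] [
   [0,14,66,80], [28,35,42,49], [0,43,62,84], [0,41,58,85], [0,51,57,86], [0,30,79,87],
   [0,28,83,88], [0,46,72,89], [0,33,68,77], [28,39,68,71], [0,60,75,76], [0,64,74,81],
   [28,30,76,81], [0,48,56,78], [0,47,71,91], [28,29,48,70], [0,3,45,73], [0,44,82,90],
   [0,36,39,52], [0,9,34,38], [0,5,18,40], [0,1,8,12]]"
    by code_simp
  from holey_cyclic[OF this] show ?thesis by simp
qed

lemma holey_0_65: "holey 0 65"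
proof -
  have "fill_check 13 5 0 [
   [28,31,32,39], [39,54,57,58], [7,8,11,39], [0,13,26,52], [20,21,24,39]] [
   [0,40,47,64], [0,42,50,62], [0,46,48,56], [13,46,47,50], [13,28,40,62], [13,32,42,56],
   [13,31,48,64], [0,20,37,43], [0,21,33,51], [0,24,34,49], [26,28,33,42], [0,14,38,60],
   [0,16,36,63], [0,22,30,59], [0,15,29,57], [0,19,35,54], [0,18,27,58], [0,17,23,25],
   [0,2,7,55], [26,56,62,64]]"
    by code_simp
  from holey_cyclic[OF this] show ?thesis by simp
qed

text \<open>The hole will receive two opposite lines, which gives 65 points and exactly one opposite
  pair.\<close>

lemma holey_8_57: "holey 8 57"
proof -
  have "fill_check 19 3 8 [
   [26,30,43,55], [8,12,47,50], [2,14,26,29]] [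
   [0,37,51,57], [0,2,25,35], [0,1,11,14], [19,20,31,33], [0,19,53,63], [0,32,56,64],
   [0,36,47,60], [0,41,50,52], [0,20,40,46], [19,38,42,56], [0,21,48,59], [0,22,44,58],
   [0,28,49,61], [0,29,45,62]]"
    by code_simp
  from holey_cyclic[OF this] show ?thesis by simp
qed

section \<open>Existence for all large orders\<close>

lemma coprime_30D:
  assumes "coprime n (30::nat)" "0 < d" "d < 7"
  shows "coprime d n"
proof -
  have "coprime n 2" "coprime n 3" "coprime n 5"
    using assms(1) by (auto elim!: coprime_divisors[rotated 2])
  then have "coprime n (2 * 2)" "coprime n (2 * 3)" "coprime n 2" "coprime n 3" "coprime n 5"
    by (simp_all only: coprime_mult_right_iff)
  moreover have "d \<in> {1, 2, 3, 4, 5, 6}" using assms(2,3) by auto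
  ultimately show ?thesis by (auto simp: coprime_commute)
qed

lemma coprime_30I:
  assumes "n mod 30 \<in> {1, 7, 11, 13, 17, 19, 23, 29}"
  shows "coprime n (30::nat)"
proof -
  have "gcd (n mod 30) 30 = 1"
    using assms by (auto simp: gcd_non_0_nat)
  then show ?thesis using coprime_mod_left_iff[of 30 n] by (simp add: coprime_iff_gcd_eq_1)
qed

text \<open>\<open>0, 5, 7, 20\<close> and the sums \<open>28 + a + b + c + d\<close> with \<open>a, b, c, d\<close> in \<open>{0, 5, 7}\<close>.\<close>

definition seeds :: "nat list" where
  "seeds = [0, 5, 7, 20, 28, 33, 35, 38, 40, 42, 43, 45, 47, 48, 49, 50, 52, 54, 56]"

text \<open>The range has length 120 because successive \<open>n\<close> congruent to 1 modulo 30
  have \<open>4 * n\<close> exactly 120 apart: the intervals \<open>4 * n + s\<close> then leave no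
  gap.\<close>

lemma seeds_sums:
  assumes s: "52 \<le> s" "s < 172"
  shows "\<exists>a b c d. {a, b, c, d} \<subseteq> set seeds \<and> s = a + b + c + d"
proof -
  \<comment> \<open>A certificate: the sums of the quadruples, in order, are 52 to 171.\<close>
  define CT :: "(nat \<times> nat \<times> nat \<times> nat) list" where "CT = [
     (0,0,0,52), (0,0,5,48), (0,0,0,54), (0,0,5,50), (0,0,0,56), (0,0,5,52), (0,0,20,38),
     (0,0,5,54), (0,0,20,40), (0,0,5,56), (0,0,20,42), (0,0,7,56), (0,5,5,54), (0,0,20,45),
     (0,0,28,38), (0,0,20,47), (0,0,20,48), (0,0,20,49), (0,0,20,50), (0,0,28,43), (0,0,20,52),
     (0,0,28,45), (0,0,20,54), (0,0,28,47), (0,0,20,56), (0,0,28,49), (0,0,28,50), (0,5,20,54),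
     (0,0,28,52), (0,0,33,48), (0,0,28,54), (0,0,33,50), (0,0,28,56), (0,0,33,52), (0,0,38,48),
     (0,0,33,54), (0,0,38,50), (0,0,33,56), (0,0,38,52), (0,0,35,56), (0,0,38,54), (0,0,43,50),
     (0,0,38,56), (0,0,43,52), (0,0,40,56), (0,0,43,54), (0,0,42,56), (0,0,43,56), (0,0,48,52),
     (0,0,45,56), (0,0,48,54), (0,0,47,56), (0,0,48,56), (0,0,49,56), (0,0,50,56), (0,5,48,54),
     (0,0,52,56), (0,5,48,56), (0,0,54,56), (0,5,50,56), (0,0,56,56), (0,5,52,56),
     (0,20,38,56), (0,5,54,56), (0,20,40,56), (0,5,56,56), (0,20,42,56), (0,7,56,56),
     (0,20,48,52), (0,20,45,56), (0,20,48,54), (0,20,47,56), (0,20,48,56), (0,20,49,56),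
     (0,20,50,56), (0,28,43,56), (0,20,52,56), (0,28,45,56), (0,20,54,56), (0,28,47,56),
     (0,20,56,56), (0,28,49,56), (0,28,50,56), (0,33,48,54), (0,28,52,56), (0,33,48,56),
     (0,28,54,56), (0,33,50,56), (0,28,56,56), (0,33,52,56), (0,38,48,56), (0,33,54,56),
     (0,38,50,56), (0,33,56,56), (0,38,52,56), (0,35,56,56), (0,38,54,56), (0,43,50,56),
     (0,38,56,56), (0,43,52,56), (0,40,56,56), (0,43,54,56), (0,42,56,56), (0,43,56,56),
     (0,48,52,56), (0,45,56,56), (0,48,54,56), (0,47,56,56), (0,48,56,56), (0,49,56,56),
     (0,50,56,56), (5,48,54,56), (0,52,56,56), (5,48,56,56), (0,54,56,56), (5,50,56,56),
     (0,56,56,56), (5,52,56,56), (20,38,56,56), (5,54,56,56)]"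
  have "map (\<lambda>(a, b, c, d). a + b + c + d) CT = [52..<172]"
    by (simp add: CT_def upt_rec)
  moreover have "s \<in> set [52..<172]" unfolding set_upt using s by simp
  ultimately have mem: "s \<in> (\<lambda>(a, b, c, d). a + b + c + d) ` set CT" by (metis set_map)
  have all: "list_all (\<lambda>(a, b, c, d). {a, b, c, d} \<subseteq> set seeds) CT"
    by (simp add: CT_def seeds_def)
  obtain t where t: "s = (\<lambda>(a, b, c, d). a + b + c + d) t" "t \<in> set CT"
    using mem by (rule imageE)
  obtain a b c d where "t = (a, b, c, d)" by (rule prod_cases4)
  then show ?thesis using t(1) bspec[OF all[unfolded list_all_iff] t(2)] by (intro exI[of _ a] exI[of _ b] exI[of _ c] exI[of _ d]) (simp only: prod.case)
qed
text \<open>Besides 7, the seeds coprime to 30 are 43, 47 and 49; they carry the second round of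
  truncations. The largest value reached is \<open>8 * 49 = 392\<close>.\<close>

lemma seeds_interval:
  assumes x: "191 \<le> x" "x < 393"
  shows "\<exists>n a b c d. x = 4 * n + (a + b + c + d) \<and> n \<in> {43, 47, 49} \<and> {a, b, c, d} \<subseteq> set seeds \<and>
    a \<le> n \<and> b \<le> n \<and> c \<le> n \<and> d \<le> n"
proof -
  define CI :: "(nat \<times> nat \<times> nat \<times> nat \<times> nat) list" where "CI = [
     (43,0,5,7,7), (43,0,0,0,20), (43,0,7,7,7), (43,5,5,5,7), (47,0,0,0,7), (43,5,5,7,7),
     (43,0,0,5,20), (43,5,7,7,7), (43,0,0,7,20), (43,0,0,0,28), (49,0,0,0,5), (43,0,5,5,20),
     (47,0,5,5,5), (43,0,5,7,20), (43,0,0,0,33), (43,0,7,7,20), (43,0,0,0,35), (47,0,0,0,20),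
     (43,5,5,7,20), (43,0,0,0,38), (43,5,7,7,20), (43,0,0,0,40), (43,7,7,7,20), (43,0,0,0,42),
     (43,0,0,0,43), (47,0,0,0,28), (43,0,0,5,40), (47,0,5,5,20), (43,0,0,5,42), (43,0,0,5,43),
     (43,0,0,7,42), (43,0,0,7,43), (47,0,0,0,35), (43,0,5,5,42), (43,0,0,20,33), (43,0,5,7,42),
     (43,0,0,20,35), (43,0,0,28,28), (43,0,7,7,43), (43,0,0,20,38), (43,5,5,7,42),
     (43,0,0,20,40), (43,0,0,28,33), (43,0,0,20,42), (43,0,0,20,43), (43,7,7,7,43),
     (43,0,5,20,40), (43,0,0,28,38), (43,0,5,20,42), (43,0,0,28,40), (43,0,7,20,42),
     (43,0,0,28,42), (43,0,0,28,43), (43,5,5,20,42), (43,0,0,33,40), (43,5,7,20,42),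
     (43,0,0,33,42), (43,0,0,33,43), (43,0,0,35,42), (43,0,0,35,43), (47,0,0,20,43),
     (43,0,0,38,42), (43,0,0,38,43), (43,0,0,40,42), (43,0,0,40,43), (43,0,0,42,42),
     (43,0,0,42,43), (43,0,0,43,43), (43,0,5,40,42), (43,0,5,40,43), (43,0,5,42,42),
     (43,0,5,42,43), (43,0,5,43,43), (43,0,7,42,43), (43,0,7,43,43), (43,0,28,28,38),
     (43,0,20,33,42), (43,0,20,33,43), (43,0,20,35,42), (43,0,20,35,43), (43,0,28,28,43),
     (43,0,20,38,42), (43,0,20,38,43), (43,0,20,40,42), (43,0,20,40,43), (43,0,20,42,42),
     (43,0,20,42,43), (43,0,20,43,43), (43,5,20,40,42), (43,0,28,38,42), (43,0,28,38,43),
     (43,0,28,40,42), (43,0,28,40,43), (43,0,28,42,42), (43,0,28,42,43), (43,0,28,43,43),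
     (43,0,33,40,42), (43,0,33,40,43), (43,0,33,42,42), (43,0,33,42,43), (43,0,33,43,43),
     (43,0,35,42,43), (43,0,35,43,43), (43,0,38,42,42), (43,0,38,42,43), (43,0,38,43,43),
     (43,0,40,42,43), (43,0,40,43,43), (43,0,42,42,43), (43,0,42,43,43), (43,0,43,43,43),
     (43,5,40,42,43), (43,5,40,43,43), (43,5,42,42,43), (43,5,42,43,43), (43,5,43,43,43),
     (43,7,42,43,43), (43,7,43,43,43), (43,20,33,42,42), (43,20,33,42,43), (43,20,33,43,43),
     (43,20,35,42,43), (43,20,35,43,43), (43,20,38,42,42), (43,20,38,42,43), (43,20,38,43,43),
     (43,20,40,42,43), (43,20,40,43,43), (43,20,42,42,43), (43,20,42,43,43), (43,20,43,43,43),
     (43,28,38,42,42), (43,28,38,42,43), (43,28,38,43,43), (43,28,40,42,43), (43,28,40,43,43),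
     (43,28,42,42,43), (43,28,42,43,43), (43,28,43,43,43), (43,33,40,42,43), (43,33,40,43,43),
     (43,33,42,42,43), (43,33,42,43,43), (43,33,43,43,43), (43,35,42,43,43), (43,35,43,43,43),
     (43,38,42,42,43), (43,38,42,43,43), (43,38,43,43,43), (43,40,42,43,43), (43,40,43,43,43),
     (43,42,42,43,43), (43,42,43,43,43), (43,43,43,43,43), (47,20,43,47,47), (47,28,38,45,47),
     (47,20,45,47,47), (47,28,38,47,47), (47,20,47,47,47), (47,28,40,47,47), (47,28,43,45,47),
     (47,28,42,47,47), (47,28,43,47,47), (47,33,43,43,47), (47,28,45,47,47), (47,33,43,45,47),
     (47,28,47,47,47), (47,33,43,47,47), (47,35,42,47,47), (47,33,45,47,47), (47,38,43,45,47),
     (47,33,47,47,47), (47,38,43,47,47), (47,35,47,47,47), (47,38,45,47,47), (47,42,42,47,47),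
     (47,38,47,47,47), (47,43,43,47,47), (47,40,47,47,47), (47,43,45,47,47), (47,42,47,47,47),
     (47,43,47,47,47), (49,33,47,48,49), (47,45,47,47,47), (49,33,48,49,49), (47,47,47,47,47),
     (49,35,48,49,49), (49,35,49,49,49), (49,38,47,49,49), (49,38,48,49,49), (49,38,49,49,49),
     (49,40,48,49,49), (49,40,49,49,49), (49,42,48,49,49), (49,42,49,49,49), (49,43,49,49,49),
     (49,45,48,49,49), (49,45,49,49,49), (49,47,48,49,49), (49,47,49,49,49), (49,48,49,49,49),
     (49,49,49,49,49)]"
  have "map (\<lambda>(n, a, b, c, d). 4 * n + (a + b + c + d)) CI = [191..<393]"
    by (simp add: CI_def upt_rec)
  moreover have "x \<in> set [191..<393]" unfolding set_upt using x by simp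
  ultimately have mem: "x \<in> (\<lambda>(n, a, b, c, d). 4 * n + (a + b + c + d)) ` set CI" by (metis set_map)
  have all: "list_all (\<lambda>(n, a, b, c, d). n \<in> {43, 47, 49} \<and> {a, b, c, d} \<subseteq> set seeds \<and>
      a \<le> n \<and> b \<le> n \<and> c \<le> n \<and> d \<le> n) CI"
    by (simp add: CI_def seeds_def)
  obtain t where t: "x = (\<lambda>(n, a, b, c, d). 4 * n + (a + b + c + d)) t" "t \<in> set CI"
    using mem by (rule imageE)
  obtain n a b c d where "t = (n, a, b, c, d)" by (rule prod_cases5)
  then show ?thesis
    using t(1) bspec[OF all[unfolded list_all_iff] t(2)]
    by (intro exI[of _ n] exI[of _ a] exI[of _ b] exI[of _ c] exI[of _ d]) (simp only: prod.case)
qed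

text \<open>Bootstrapping: the seeds give all values from 191 to 392, and these serve as
  \<open>n\<close>, \<open>a\<close>, \<open>b\<close>, \<open>c\<close>, \<open>d\<close> in turn.
  Explicit ranges reach up to 3175; from 3176 on, strong induction provides a suitable
  \<open>n\<close> that is at least 768 and less than \<open>x\<close>.\<close>

lemma truncation_closed_cofinite:
  fixes X :: "nat set"
  assumes X: "0 \<in> X" "5 \<in> X" "7 \<in> X" "20 \<in> X"
    and R: "\<And>n a b c d. n \<in> X \<Longrightarrow> coprime n 30 \<Longrightarrow> {a, b, c, d} \<subseteq> X \<Longrightarrow> a \<le> n \<Longrightarrow> b \<le> n \<Longrightarrow>
      c \<le> n \<Longrightarrow> d \<le> n \<Longrightarrow> 4 * n + (a + b + c + d) \<in> X"
    and x: "768 \<le> x"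
  shows "x \<in> X"
proof -
  have 7: "28 + (a + b + c + d) \<in> X" if "{a, b, c, d} \<subseteq> {0, 5, 7}" for a b c d
  proof -
    have "coprime 7 (30::nat)" by (rule coprime_30I) simp
    then show ?thesis using R[of 7 a b c d] X that by auto
  qed
  have Xs: "set seeds \<subseteq> X"
    using X 7[of 0 0 0 0] 7[of 5 0 0 0] 7[of 7 0 0 0] 7[of 5 5 0 0] 7[of 5 7 0 0] 7[of 7 7 0 0]
      7[of 5 5 5 0] 7[of 5 5 7 0] 7[of 5 7 7 0] 7[of 5 5 5 5] 7[of 7 7 7 0] 7[of 5 5 5 7]
      7[of 5 5 7 7] 7[of 5 7 7 7] 7[of 7 7 7 7]
    by (simp add: seeds_def)
  have Xle: "a \<le> 56" if "a \<in> set seeds" for a using that by (auto simp: seeds_def)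
  have cop: "coprime n (30::nat)" if "n \<in> {7, 43, 47, 49, 179, 187, 361, 391, 769}" for n
    by (rule coprime_30I) (use that in auto)
  have I: "x \<in> X" if x: "191 \<le> x" "x < 393" for x
  proof -
    obtain n a b c d where *: "x = 4 * n + (a + b + c + d)" "n \<in> {43, 47, 49}"
      "{a, b, c, d} \<subseteq> set seeds" "a \<le> n" "b \<le> n" "c \<le> n" "d \<le> n"
      using seeds_interval[OF x] by (elim exE conjE) (rule that)
    have "n \<in> X" using *(2) Xs by (auto simp: seeds_def)
    moreover have "coprime n 30" by (rule cop) (use *(2) in auto)
    moreover have "{a, b, c, d} \<subseteq> X" using *(3) Xs by (rule subset_trans)
    ultimately show ?thesis unfolding *(1) using *(4-7) by (rule R)
  qed
  \<comment> \<open>Seeds are at most 56, so for \<open>n \<ge> 56\<close> all of them are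
    admissible as truncated group sizes.\<close>
  have small: "x \<in> X" if "n \<in> X" "coprime n 30" "56 \<le> n" "4 * n + 52 \<le> x" "x < 4 * n + 172" for n x
  proof -
    have "52 \<le> x - 4 * n" "x - 4 * n < 172" using that(4,5) by simp_all
    then obtain a b c d where *: "{a, b, c, d} \<subseteq> set seeds" "x - 4 * n = a + b + c + d"
      using seeds_sums by blast
    have "a \<le> n" "b \<le> n" "c \<le> n" "d \<le> n" using *(1) Xle \<open>56 \<le> n\<close> by (auto intro: order_trans)
    then have "4 * n + (a + b + c + d) \<in> X" using R[OF that(1,2)] *(1) Xs by blast
    moreover have "x = 4 * n + (a + b + c + d)" using *(2) that(4) by simp
    ultimately show ?thesis by simp
  qed
  have "43 \<in> X" using Xs by (simp add: seeds_def)
  \<comment> \<open>Here \<open>179 = 4 * 43 + 7\<close> and \<open>187 = 4 * 43 + 15\<close>. The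
    lower end 768 is \<open>4 * 179 + 52\<close>.\<close>
  then have 179: "179 \<in> X" "187 \<in> X"
    using R[of 43 0 0 0 7] R[of 43 0 5 5 5] X cop[of 43] by simp_all
  have A: "x \<in> X" if x: "768 \<le> x" "x < 896" for x
  proof (cases "x < 888")
    case True
    show ?thesis by (rule small[OF 179(1) cop]) (use x True in simp_all)
  next
    case False
    show ?thesis by (rule small[OF 179(2) cop]) (use x False in simp_all)
  qed
  have B: "x \<in> X" if x: "896 \<le> x" "x < 1736" for x
  proof -
    \<comment> \<open>Since \<open>4 * n + 52 = 120 * t + 56\<close>, subtracting 56 before dividing
      puts \<open>x\<close> into the interval belonging to \<open>n\<close>.\<close>
    define t where "t = (x - 56) div 120"
    define n where "n = 30 * t + 1"
    have "120 * t \<le> x - 56" "x - 56 < 120 * t + 120" unfolding t_def by (simp_all add: mult.commute)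
    then have t: "120 * t + 56 \<le> x" "x < 120 * t + 176" using x by simp_all
    then have "7 \<le> t" "t \<le> 13" using x by simp_all
    then have n: "4 * n + 52 \<le> x" "x < 4 * n + 172" "211 \<le> n" "n \<le> 391"
      using t by (simp_all add: n_def)
    have c: "coprime n 30" by (rule coprime_30I) (simp add: n_def mod_Suc)
    have "n \<in> X" by (rule I) (use n in simp_all)
    from this c show ?thesis by (rule small) (use n in simp_all)
  qed
  have C: "x \<in> X" if x: "1736 \<le> x" "x < 1755" for x
  proof -
    \<comment> \<open>One truncated group, of size between 292 and 310, bridges this short
      range.\<close>
    have "4 * 361 + (x - 1444 + 0 + 0 + 0) \<in> X"
    proof (rule R)
      show "361 \<in> X" "{x - 1444, 0, 0, 0} \<subseteq> X" using I[of 361] I[of "x - 1444"] X(1) x by simp_all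
    qed (use x cop in simp_all)
    then show ?thesis using x by simp
  qed
  have D: "x \<in> X" if x: "1755 \<le> x" "x \<le> 3128" for x
  proof -
    have *: "1564 + (a + b + c + d) \<in> X"
      if "{a, b, c, d} \<subseteq> {0} \<union> {191..391}" for a b c d
    proof -
      have e: "e \<in> X" "e \<le> 391" if "e \<in> {0} \<union> {191..391}" for e using that I[of e] X(1) by auto
      have m: "a \<in> {0} \<union> {191..391}" "b \<in> {0} \<union> {191..391}"
        "c \<in> {0} \<union> {191..391}" "d \<in> {0} \<union> {191..391}" using that by simp_all
      have "{a, b, c, d} \<subseteq> X" "a \<le> 391" "b \<le> 391" "c \<le> 391" "d \<le> 391"
        using m[THEN e(1)] m[THEN e(2)] by simp_all
      moreover have "391 \<in> X" by (rule I) simp_all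
      moreover have "coprime 391 (30::nat)" by (rule cop) simp
      ultimately have "4 * 391 + (a + b + c + d) \<in> X" by (intro R) simp_all
      then show ?thesis by simp
    qed
    define s where "s = x - 1564"
    have s: "x = 1564 + s" "191 \<le> s" "s \<le> 1564" using x by (auto simp: s_def)
    \<comment> \<open>With \<open>n = 391\<close> and \<open>4 * 391 = 1564\<close>, the rest
      \<open>s\<close> is split into one to four nearly equal parts, each between 191 and
      391.\<close>
    consider "s \<le> 391" | "392 \<le> s" "s \<le> 782" | "783 \<le> s" "s \<le> 1173" | "1174 \<le> s" by linarith
    then show ?thesis
    proof cases
      case 1
      then have "{s, 0, 0, 0} \<subseteq> {0} \<union> {191..391}" using s(2) by simp
      from *[OF this] show ?thesis unfolding s(1) by simp
    next
      case 2
      have e: "s = s div 2 + (s + 1) div 2 + 0 + 0" by presburger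
      have "{s div 2, (s + 1) div 2, 0, 0} \<subseteq> {0} \<union> {191..391}" using 2 by auto
      from *[OF this] show ?thesis unfolding s(1) e[symmetric] .
    next
      case 3
      have e: "s = s div 3 + (s + 1) div 3 + (s + 2) div 3 + 0" by presburger
      have "{s div 3, (s + 1) div 3, (s + 2) div 3, 0} \<subseteq> {0} \<union> {191..391}" using 3 by auto
      from *[OF this] show ?thesis unfolding s(1) e[symmetric] .
    next
      case 4
      have half: "i = i div 2 + (i + 1) div 2" for i :: nat by presburger
      define h k where "h = s div 2" and "k = (s + 1) div 2"
      have hk: "587 \<le> h" "h \<le> 782" "587 \<le> k" "k \<le> 782"
        using 4 s(3) unfolding h_def k_def by simp_all
      have e: "s = h div 2 + (h + 1) div 2 + k div 2 + (k + 1) div 2"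
        using half[of s] half[of h] half[of k] unfolding h_def[symmetric] k_def[symmetric] by linarith
      have "{h div 2, (h + 1) div 2, k div 2, (k + 1) div 2} \<subseteq> {0} \<union> {191..391}"
        using hk by auto
      from *[OF this] show ?thesis unfolding s(1) e[symmetric] .
    qed
  qed
  show ?thesis using x
  proof (induction x rule: less_induct)
    case (less x)
    consider "x < 896" | "896 \<le> x" "x < 1736" | "1736 \<le> x" "x < 1755" | "1755 \<le> x" "x \<le> 3128"
      | "3129 \<le> x" "x < 3176" | "3176 \<le> x" by linarith
    then show ?case
    proof cases
      case 5
      have "769 \<in> X" by (rule A) simp_all
      then show ?thesis by (rule small[OF _ cop]) (use 5 in simp_all)
    next
      case 6
      define t where "t = (x - 56) div 120"
      define n where "n = 30 * t + 1"
      have "120 * t \<le> x - 56" "x - 56 < 120 * t + 120" unfolding t_def by (simp_all add: mult.commute)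
      then have t: "120 * t + 56 \<le> x" "x < 120 * t + 176" using 6 by simp_all
      then have "26 \<le> t" using 6 by simp
      then have n: "4 * n + 52 \<le> x" "x < 4 * n + 172" "768 \<le> n" "n < x"
        using t by (simp_all add: n_def)
      have c: "coprime n 30" by (rule coprime_30I) (simp add: n_def mod_Suc)
      have "n \<in> X" by (rule less.IH) (use n in simp_all)
      from this c show ?thesis by (rule small) (use n in simp_all)
    qed (use A[of x] B[of x] C[of x] D[of x] less.prems in simp_all)
  qed
qed

section \<open>Geometries of all large orders\<close>

lemma gdd_12:
  assumes "4 \<le> s" "s \<le> 8"
  shows "gdd {4} 12 s"
proof -
  have "s = 4 \<or> s = 5 \<or> s = 6 \<or> s = 7 \<or> s = 8" using assms by auto
  then show ?thesis using gdd_12_4 gdd_12_5 gdd_12_6 gdd_12_7 gdd_12_8 by auto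
qed

lemma decomp_single: "card B \<in> K \<Longrightarrow> 2 \<le> card B \<Longrightarrow> decomp K (complete B) {B}"
  by (rule decompI) auto

text \<open>The degenerate \<open>PENT(4, 1)\<close>: two disjoint lines, whose deficiency graph is
  complete bipartite with sides of four points.\<close>

lemma penta_8_1: "penta 8 1"
proof -
  let ?l = "{0..<4::nat}" and ?m = "{4..<8::nat}"
  define D where "D = ?l \<times> ?m \<union> ?m \<times> ?l"
  have Dl: "D `` {x} = ?m" if "x \<in> ?l" for x using that by (auto simp: D_def)
  have Dm: "D `` {x} = ?l" if "x \<in> ?m" for x using that by (auto simp: D_def)
  have dom: "x \<in> ?l \<or> x \<in> ?m" if "D `` {x} \<noteq> {}" for x using that by (auto simp: D_def)
  have "decomp {4} (complete ?l \<union> complete ?m) ({?l} \<union> {?m})"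
  proof (rule decomp_Un)
    show "decomp {4} (complete ?l) {?l}" "decomp {4} (complete ?m) {?m}"
      by (rule decomp_single; simp)+
  qed (auto simp: complete_def)
  moreover have "complete ?l \<union> complete ?m = complete ({0..<8} \<union> {}) - complete {} - D"
    by (auto simp: complete_def D_def)
  ultimately have "fill {0..<8} {} D ({?l} \<union> {?m})"
    unfolding fill_def using Dl Dm by (auto simp: D_def complete_def sym_def)
  moreover have "opps D = {{?l, ?m}}"
  proof (intro equalityI subsetI)
    fix p assume "p \<in> {{?l, ?m}}"
    then have p: "p = {?l, ?m}" by simp
    show "p \<in> opps D" unfolding p by (rule oppsI) (use Dl Dm in auto)
  next
    fix p assume p: "p \<in> opps D"
    have "D \<subseteq> complete {0..<8}" by (auto simp: D_def complete_def)
    from p this obtain l m where lm: "p = {l, m}" "l \<noteq> {}" "m \<noteq> {}" "\<forall>x\<in>l. D `` {x} = m" "\<forall>x\<in>m. D `` {x} = l"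
      by (rule oppsE) (rule that)
    obtain x y where xy: "x \<in> l" "y \<in> m" using lm(2,3) by blast
    have x: "D `` {x} = m" and y: "D `` {y} = l" using lm(4,5) xy by simp_all
    have "x \<in> ?l \<or> x \<in> ?m" using dom[of x] x lm(3) by simp
    then have "m = ?m \<or> m = ?l" using Dl Dm x by blast
    then have "m = ?m \<and> l = ?l \<or> m = ?l \<and> l = ?m" using Dl[of y] Dm[of y] xy(2) y by blast
    then show "p \<in> {{?l, ?m}}" using lm(1) by auto
  qed
  ultimately show ?thesis using pentaI[of "{0..<8::nat}" D "{?l} \<union> {?m}"] by simp
qed

lemma penta_65: "penta 65 0" "penta 65 1"
proof -
  obtain A W :: "int set" and D L where "finite A" "card A = 65" "finite W" "card W = 0" "fill A W D L" "opps D = {}"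
    using holey_0_65 unfolding holey_def by blast
  then have "finite A" "card A = 65" "fill A {} D L" "opps D = {}" by simp_all
  then show "penta 65 0" unfolding penta_def by (intro exI[of _ A] exI[of _ D] exI[of _ L]) simp
  show "penta 65 1" using holey_penta[OF holey_8_57 penta_8_1] by simp
qed

lemma holey_cofinite:
  assumes h: "holey w 60" "holey w 84" and x: "768 \<le> x"
  shows "holey w (12 * x)"
proof -
  have "x \<in> {x. holey w (12 * x)}"
  proof (rule truncation_closed_cofinite[OF _ _ _ _ _ x])
    \<comment> \<open>As 5 is not coprime to 30, the value 20 is obtained separately: all four
      groups of a \<open>TD(4, 5)\<close> are filled.\<close>
    have "gdd {4} 5 4"
    proof (rule gdd_transversal)
      show "coprime d 5" if "0 < d" "d < 4 - 1" for d :: nat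
      proof -
        have "d = 1 \<or> d = 2" using that by auto
        then show ?thesis by (auto simp: coprime_iff_gcd_eq_1 gcd_non_0_nat)
      qed
    qed simp
    then have "holey (w + 12 * (\<Sum>i\<in>{4..<4::nat}. 5)) (12 * (\<Sum>i<4::nat. 5))"
      by (rule holey_truncated) (use gdd_12 h(1) in auto)
    then show "20 \<in> {x. holey w (12 * x)}" by simp
    fix n a b c d
    assume n: "n \<in> {x. holey w (12 * x)}" "coprime n 30" and abcd: "{a, b, c, d} \<subseteq> {x. holey w (12 * x)}"
      and le: "a \<le> n" "b \<le> n" "c \<le> n" "d \<le> n"
    \<comment> \<open>Eight groups, four complete and four truncated, all filled around the hole.
      \<open>TD(8, n)\<close> needs 1 to 6 to be invertible modulo \<open>n\<close>, which follows
      from coprimality to 30.\<close>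
    define f where "f i = (if i < 4 then n else if i = 4 then a else if i = 5 then b else if i = 6 then c else d)"
      for i :: nat
    have "gdd {8} n 8" by (rule gdd_transversal) (use coprime_30D[OF n(2)] in auto)
    then have "holey (w + 12 * (\<Sum>i\<in>{8..<8}. f i)) (12 * (\<Sum>i<8. f i))"
      by (rule holey_truncated) (use gdd_12 n(1) abcd le in \<open>auto simp: f_def\<close>)
    moreover have "(\<Sum>i<8. f i) = 4 * n + (a + b + c + d)"
      by (simp add: f_def eval_nat_numeral lessThan_Suc)
    ultimately show "4 * n + (a + b + c + d) \<in> {x. holey w (12 * x)}" by simp
  qed (use h holey_0 in auto)
  then show ?thesis by simp
qed

text \<open>Six groups: four of size \<open>n\<close>, one of size \<open>m\<close> between 768 and
  887, and one of size \<open>q\<close>. The last group together with the hole receives the given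
  geometry; the others carry no opposite pairs.\<close>

lemma penta_eventually:
  assumes h: "holey w 60" "holey w 84" and q: "penta (12 * q + w) j"
  shows "\<exists>N. \<forall>x\<ge>N. penta (12 * x + w) j"
proof (intro exI allI impI)
  \<comment> \<open>The 772 is \<open>768 + 4\<close>, as \<open>4 * n = 120 * t + 4\<close>. The
    term \<open>120 * (q + 30)\<close> forces \<open>t \<ge> q + 30\<close>, so that
    \<open>q\<close> and \<open>m\<close> do not exceed \<open>n\<close>.\<close>
  fix x assume x: "q + 772 + 120 * (q + 30) \<le> x"
  define t where "t = (x - (q + 772)) div 120"
  define n where "n = 30 * t + 1"
  define m where "m = x - q - 4 * n"
  have "120 * (q + 30) \<le> x - (q + 772)" using x by simp
  then have t: "q + 30 \<le> t" unfolding t_def by (simp add: less_eq_div_iff_mult_less_eq)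
  have "120 * t \<le> x - (q + 772)" "x - (q + 772) < 120 * t + 120"
    unfolding t_def by (simp_all add: mult.commute)
  then have xm: "x = 4 * n + (m + q)" and m: "768 \<le> m" "m < 888"
    using x unfolding m_def n_def by simp_all
  have n: "888 \<le> n" "q \<le> n" using t by (simp_all add: n_def)
  have cop: "coprime n 30" by (rule coprime_30I) (simp add: n_def mod_mult_self3 mod_Suc)
  define f where "f i = (if i < 4 then n else if i = 4 then m else q)" for i :: nat
  have "gdd {6} n 6" by (rule gdd_transversal) (use coprime_30D[OF cop] in auto)
  then have "holey (w + 12 * (\<Sum>i\<in>{5..<6}. f i)) (12 * (\<Sum>i<5. f i))"
    by (rule holey_truncated) (use gdd_12 holey_cofinite[OF h] n m in \<open>auto simp: f_def\<close>)
  moreover have "(\<Sum>i<5. f i) = 4 * n + m" "(\<Sum>i\<in>{5..<6}. f i) = q"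
    by (simp_all add: f_def eval_nat_numeral lessThan_Suc)
  ultimately have "holey (12 * q + w) (12 * (4 * n + m))" by (simp add: add.commute)
  from holey_penta[OF this q] show "penta (12 * x + w) j"
    unfolding xm by (simp add: algebra_simps)
qed

text \<open>Among the first three groups only the differences 1 and 2 occur, so odd \<open>n\<close>
  suffices.\<close>

lemma gdd_transversal_4:
  assumes "odd n"
  shows "gdd {4} n 4"
proof (rule gdd_transversal)
  fix d :: nat assume "0 < d" "d < 4 - 1"
  then have "d = 1 \<or> d = 2" by auto
  then show "coprime d n" using assms by (auto simp: coprime_left_2_iff_odd)
qed simp

lemma penta_5_mod_12: "\<exists>N. \<forall>x\<ge>N. penta (12 * x + 5) j"
proof (induction j)
  case 0
  show ?case by (rule penta_eventually[OF holey_5_60 holey_5_84, of 5]) (use penta_65 in simp)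
next
  case (Suc j)
  obtain N where N: "\<forall>x\<ge>N. penta (12 * x + 5) j" using Suc by blast
  obtain N0 where N0: "\<forall>x\<ge>N0. penta (12 * x + 5) 0"
    using penta_eventually[OF holey_5_60 holey_5_84, of 5 0] penta_65 by auto
  obtain N1 where N1: "\<forall>x\<ge>N1. penta (12 * x + 5) 1"
    using penta_eventually[OF holey_5_60 holey_5_84, of 5 1] penta_65 by auto
  define x where "x = N + N0 + N1"
  let ?v = "12 * x + 5"
  have "N \<le> x" "N0 \<le> x" "N1 \<le> x" by (simp_all add: x_def)
  then have P: "penta ?v j" "penta ?v 0" "penta ?v 1" using N N0 N1 by blast+
  \<comment> \<open>Each point of the projective plane of order 3 gets the odd weight
    \<open>?v\<close>, and each of its lines is replaced by a \<open>TD(4, ?v)\<close>.\<close>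
  have "gdd {4} (1 * ?v) 13" by (rule gdd_mult[OF gdd_1_13]) (simp add: gdd_transversal_4)
  then have g: "gdd {4} ?v 13" by simp
  \<comment> \<open>One group carries \<open>j\<close> pairs, another carries one, and the remaining
    eleven carry none. As 13 is 1 modulo 12, the total order is again 5 modulo 12.\<close>
  define f where "f i = (if i = 0 then j else if i = 1 then 1 else 0)" for i :: nat
  have "penta (13 * ?v) (\<Sum>i<13. f i)"
    by (rule penta_mult[OF g]) (use P in \<open>simp add: f_def\<close>)
  moreover have "(\<Sum>i<13. f i) = Suc j"
    by (simp add: f_def eval_nat_numeral lessThan_Suc)
  ultimately have "penta (12 * (13 * x + 5) + 5) (Suc j)" by (simp add: algebra_simps)
  then show ?case by (rule penta_eventually[OF holey_5_60 holey_5_84])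
qed

lemma penta_8_mod_12: "\<exists>N. \<forall>x\<ge>N. penta (12 * x + 8) j"
proof -
  obtain N where N: "\<forall>x\<ge>N. penta (12 * x + 5) j" using penta_5_mod_12 by blast
  obtain N0 where N0: "\<forall>x\<ge>N0. penta (12 * x + 5) 0" using penta_5_mod_12 by blast
  define x where "x = N + N0"
  let ?v = "12 * x + 5"
  have "N \<le> x" "N0 \<le> x" by (simp_all add: x_def)
  then have P: "penta ?v j" "penta ?v 0" using N N0 by blast+
  define f where "f i = (if i = 0 then j else 0)" for i :: nat
  have "gdd {4} ?v 4" by (rule gdd_transversal_4) simp
  then have "penta (4 * ?v) (\<Sum>i<4. f i)"
    by (rule penta_mult) (use P in \<open>simp add: f_def\<close>)
  moreover have "(\<Sum>i<4. f i) = j"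
    by (simp add: f_def eval_nat_numeral lessThan_Suc)
  \<comment> \<open>Four groups turn the residue 5 into 20, that is, 8 modulo 12.\<close>
  ultimately have "penta (12 * (4 * x + 1) + 8) j" by (simp add: algebra_simps)
  then show ?thesis by (rule penta_eventually[OF holey_8_60 holey_8_84])
qed

theorem theorem3p4:
  fixes j :: nat
  shows "\<exists>r0::nat. \<forall>r\<ge>r0. r mod 4 = 0 \<or> r mod 4 = 1 \<longrightarrow>
    (\<exists>(V :: nat set) L. PENT 4 r V L \<and> card (opposite_line_pairs V L) = j)"
proof -
  obtain N where N: "\<forall>x\<ge>N. penta (12 * x + 5) j" using penta_5_mod_12 by blast
  obtain M where M: "\<forall>x\<ge>M. penta (12 * x + 8) j" using penta_8_mod_12 by blast
  show ?thesis
  \<comment> \<open>The summand 4 makes \<open>r\<close> positive; the rest makes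
    \<open>r div 4\<close> at least \<open>N\<close> and \<open>M\<close>.\<close>
  proof (intro exI[of _ "4 * (N + M) + 4"] allI impI)
    fix r :: nat
    assume r: "4 * (N + M) + 4 \<le> r" "r mod 4 = 0 \<or> r mod 4 = 1"
    define x where "x = r div 4"
    have x: "N \<le> x" "M \<le> x" using r(1) by (simp_all add: x_def)
    \<comment> \<open>The number of points is \<open>3 * r + 5\<close>: the point itself, its four
      non-collinear points, and three further points on each of its \<open>r\<close> lines.\<close>
    have "3 * r + 5 = 12 * x + 5 \<or> 3 * r + 5 = 12 * x + 8"
      using r(2) unfolding x_def by presburger
    then have "penta (3 * r + 5) j"
      using N[rule_format, OF x(1)] M[rule_format, OF x(2)] by (elim disjE) (simp_all only:)
    then show "\<exists>(V :: nat set) L. PENT 4 r V L \<and> card (opposite_line_pairs V L) = j"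
      by (rule penta_PENT) (use r(1) in simp)
  qed
qed

end
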